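(* Let $X$ be an infinite set, $\mathcal{F}$ a non-principal ultrafilter on $X$, and $\min(\mathcal{F})$ the least cardinality of an element of $\mathcal{F}$. Then the maximal subsemigroups of $I_X$ which contain $\operatorname{Sym}(X)_{\{\mathcal{F}\}}$ but not $\operatorname{Sym}(X)$ are exactly $$\begin{aligned} V_{\mathcal{F}, \mu} =\{f \in I_X :\ &c(f)\geq \mu \text{ or } \operatorname{dom}(f) \notin \mathcal{F} \text{ or } \\ &((\forall \Sigma \subseteq X)(\Sigma \in \mathcal{F} \iff \Sigma f \in \mathcal{F}) \text{ and } d(f)<\mu)\} \cup \mathfrak{F},\end{aligned}$$ $$\begin{aligned} V_{\mathcal{F}, \mu}^{-1} = \{f \in I_X :\ &d(f)\geq \mu \text{ or } \operatorname{im}(f) \notin \mathcal{F} \text{ or } \\ &((\forall \Sigma \subseteq X)(\Sigma \in \mathcal{F} \iff \Sigma f \in \mathcal{F})\text{ and }c(f)<\mu)\}\cup \mathfrak{F}\end{aligned}$$ for any cardinal $\mu$ with $\min(\mathcal{F})<\mu \leq |X|^+$. The maximal inverse subsemigroups of $I_X$ which contain $\operatorname{Sym}(X)_{\{\mathcal{F}\}}$ but not $\operatorname{Sym}(X)$ are exactly $$\begin{aligned} V_{\mathcal{F}, \mu} \cap V_{\mathcal{F}, \mu}^{-1} = \{f \in I_X :\ &(c(f) \geq \mu \text{ and }d(f) \geq \mu) \text{ or } (c(f) \geq \mu \text{ and }\operatorname{im}(f) \notin \mathcal{F}) \text{ or } \\ &(\operatorname{dom}(f) \notin \mathcal{F}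 \text{ and }d(f) \geq \mu) \text{ or } (\operatorname{dom}(f) \notin \mathcal{F} \text{ and }\operatorname{im}(f) \notin \mathcal{F}) \text{ or } \\ &((\forall \Sigma \subseteq X)(\Sigma f \in \mathcal{F} \iff \Sigma \in \mathcal{F}) \text{ and } c(f) + d(f)<\mu)\} \cup \mathfrak{F}\end{aligned}$$ over the same values of $\mu$.
   Context: $I_X$ denotes the symmetric inverse monoid on $X$: the set of all injective partial functions from $X$ to $X$ (bijections between subsets of $X$, including the empty one) under composition of partial functions, written on the right and composed from left to right. $\operatorname{Sym}(X)\subseteq I_X$ is the group of all permutations of $X$. The stabiliser of a filter $\mathcal{F}$ on $X$ is $\operatorname{Sym}(X)_{\{\mathcal{F}\}}=\{f\in\operatorname{Sym}(X): (\forall\Sigma\subseteq X)(\Sigma\in\mathcal{F}\iff\Sigma f\in\mathcal{F})\}$. For $f\in I_X$: $c(f)=|X\setminus \operatorname{dom}(f)|$ (collapse), $d(f)=|X\setminus\operatorname{im}(f)|$ (defect), $r(f)=|\operatorname{im}(f)|$ (rank). For $\Sigma\subseteq X$, $\Sigma f=\{xf: x\in\Sigma\cap\operatorname{dom}(f)\}$. $\mathfrak{F}=\{f\in I_X: r(f)<|X|\}$ (not to be confused with the ultrafilter $\mathcal{F}$). $|X|^+$ is the successor cardinal of $|X|$. For $M\subseteq I_X$, $M^{-1}=\{f^{-1}:f\in M\}$. An ultrafilter is non-principal if it is not of the form $\{\Sigma\subseteq X: x\in\Sigma\}$ for some $x\in X$. An inverse subsemigroup is a subsemigroup closed under $f\mapsto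 f^{-1}$. A maximal subsemigroup (respectively maximal inverse subsemigroup) is a maximal element, under containment, of the set of all proper subsemigroups (respectively proper inverse subsemigroups). *)

theory Defs
  imports Main
begin

unbundle cardinal_syntax

text \<open>
  Partial functions are represented by their graphs, so that the left-to-right composite of
  \<open>f\<close> and \<open>g\<close> is the relational composite \<open>f O g\<close>, the inverse is \<open>f\<inverse>\<close>, and the image
  \<open>\<Sigma>f = {xf : x \<in> \<Sigma> \<inter> dom f}\<close> is \<open>f `` \<Sigma>\<close>.
\<close>

definition sym_inv_monoid :: "'a set \<Rightarrow> 'a rel set"
  where "sym_inv_monoid X = {f. f \<subseteq> X \<times> X \<and> single_valued f \<and> single_valued (f\<inverse>)}"

definition Sym :: "'a set \<Rightarrow> 'a rel set"
  where "Sym X = {f \<in> sym_inv_monoid X. Domain f = X \<and> Range f = X}"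

definition collapse :: "'a set \<Rightarrow> 'a rel \<Rightarrow> 'a rel"
  where "collapse X f = |X - Domain f|"

definition defect :: "'a set \<Rightarrow> 'a rel \<Rightarrow> 'a rel"
  where "defect X f = |X - Range f|"

definition rank :: "'a rel \<Rightarrow> 'a rel"
  where "rank f = |Range f|"

definition small_rank :: "'a set \<Rightarrow> 'a rel set"
  where "small_rank X = {f \<in> sym_inv_monoid X. rank f <o |X|}"

definition filter_on :: "'a set \<Rightarrow> 'a set set \<Rightarrow> bool"
  where "filter_on X F \<longleftrightarrow>
    F \<subseteq> Pow X \<and> X \<in> F \<and> {} \<notin> F \<and>
    (\<forall>A\<in>F. \<forall>B\<in>F. A \<inter> B \<in> F) \<and>
    (\<forall>A\<in>F. \<forall>B\<subseteq>X. A \<subseteq> B \<longrightarrow> B \<in> F)"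

definition ultrafilter_on :: "'a set \<Rightarrow> 'a set set \<Rightarrow> bool"
  where "ultrafilter_on X F \<longleftrightarrow> filter_on X F \<and> (\<forall>A\<subseteq>X. A \<in> F \<or> X - A \<in> F)"

definition nonprincipal :: "'a set \<Rightarrow> 'a set set \<Rightarrow> bool"
  where "nonprincipal X F \<longleftrightarrow> \<not> (\<exists>x\<in>X. F = {S. S \<subseteq> X \<and> x \<in> S})"

definition preserves :: "'a set \<Rightarrow> 'a set set \<Rightarrow> 'a rel \<Rightarrow> bool"
  where "preserves X F f \<longleftrightarrow> (\<forall>S\<subseteq>X. S \<in> F \<longleftrightarrow> f `` S \<in> F)"

definition filter_stabiliser :: "'a set \<Rightarrow> 'a set set \<Rightarrow> 'a rel set"
  where "filter_stabiliser X F = {f \<in> Sym X. preserves X F f}"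

text \<open>
  The cardinal \<open>min(F)\<close>; the chosen set exists whenever \<open>F\<close> is non-empty, and its cardinality
  does not depend on the choice.
\<close>

definition min_card :: "'a set set \<Rightarrow> 'a rel"
  where "min_card F = |SOME S. S \<in> F \<and> (\<forall>T\<in>F. |S| \<le>o |T| )|"

text \<open>
  The cardinals \<open>\<mu>\<close> with \<open>min(F) < \<mu> \<le> |X|\<^sup>+\<close>. Since \<open>cardSuc |X|\<close> lives on the type \<open>'a set\<close>,
  every cardinal in this range, of whatever type, is \<open>=o\<close> to some \<open>\<mu> :: 'a set rel\<close>, so fixing
  this type loses nothing. (A cardinal is represented by many cardinal orders, but everything below
  depends on \<open>\<mu>\<close> only up to \<open>=o\<close>.)
\<close>

definition filter_cardinals :: "'a set \<Rightarrow> 'a set set \<Rightarrow> 'a set rel set"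
  where "filter_cardinals X F = {\<mu>. Card_order \<mu> \<and> min_card F <o \<mu> \<and> \<mu> \<le>o cardSuc |X|}"

definition V :: "'a set \<Rightarrow> 'a set set \<Rightarrow> 'a set rel \<Rightarrow> 'a rel set"
  where "V X F \<mu> =
    {f \<in> sym_inv_monoid X.
       \<mu> \<le>o collapse X f \<or> Domain f \<notin> F \<or> (preserves X F f \<and> defect X f <o \<mu>)}
    \<union> small_rank X"

definition setwise_inverse :: "'a rel set \<Rightarrow> 'a rel set"
  where "setwise_inverse M = converse ` M"

text \<open>
  The empty set counts as a subsemigroup here; this does not affect which subsemigroups
  are maximal, as there are non-empty proper (inverse) subsemigroups such as \<open>{{}}\<close>.
\<close>

definition subsemigroup :: "'a set \<Rightarrow> 'a rel set \<Rightarrow> bool"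
  where "subsemigroup X M \<longleftrightarrow> M \<subseteq> sym_inv_monoid X \<and> (\<forall>f\<in>M. \<forall>g\<in>M. f O g \<in> M)"

definition inverse_subsemigroup :: "'a set \<Rightarrow> 'a rel set \<Rightarrow> bool"
  where "inverse_subsemigroup X M \<longleftrightarrow> subsemigroup X M \<and> (\<forall>f\<in>M. f\<inverse> \<in> M)"

definition maximal_subsemigroup :: "'a set \<Rightarrow> 'a rel set \<Rightarrow> bool"
  where "maximal_subsemigroup X M \<longleftrightarrow>
    subsemigroup X M \<and> M \<noteq> sym_inv_monoid X \<and>
    (\<forall>N. subsemigroup X N \<and> N \<noteq> sym_inv_monoid X \<and> M \<subseteq> N \<longrightarrow> N = M)"

definition maximal_inverse_subsemigroup :: "'a set \<Rightarrow> 'a rel set \<Rightarrow> bool"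
  where "maximal_inverse_subsemigroup X M \<longleftrightarrow>
    inverse_subsemigroup X M \<and> M \<noteq> sym_inv_monoid X \<and>
    (\<forall>N. inverse_subsemigroup X N \<and> N \<noteq> sym_inv_monoid X \<and> M \<subseteq> N \<longrightarrow> N = M)"

end

theory Submission
  imports Defs
begin

text \<open>
  Write \<open>c\<close> and \<open>d\<close> for collapse and defect, and \<open>m\<close> for \<open>min(F)\<close>; call a partial bijection
  \<open>f\<close> total if its domain is \<open>X\<close>. Everything rests on the fact that a permutation which fixes a
  set of \<open>F\<close> pointwise stabilises \<open>F\<close>. A set of \<open>F\<close> can be thinned out inside \<open>F\<close> until it
  leaves as many points free as it had at the start, so a partial bijection whose domain and range
  are outside \<open>F\<close> and have equinumerous complements extends to an element of the stabiliser
  (\<open>extend_to_stabiliser\<close>). The stabiliser is therefore large enough to move sets about almost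
  freely.

  \<^emph>\<open>The semigroups \<open>V\<close> are maximal.\<close> Closure under composition is cardinal arithmetic. Suppose that
  \<open>f \<notin> V\<close>. Then \<open>c f < \<mu>\<close> and \<open>Domain f \<in> F\<close>, so \<open>f\<close> can be preceded by some \<open>s\<close> in
  \<open>V \<inter> V\<inverse>\<close> that makes the product \<open>k = s O f\<close> total; this costs fewer than \<open>\<mu>\<close> points. If
  \<open>f\<close> does not preserve \<open>F\<close>, then since \<open>m < \<mu>\<close> the map \<open>s\<close> can also avoid the preimage of a
  set of \<open>F\<close> of cardinality at most \<open>m\<close>, which forces \<open>Range k \<notin> F\<close>; otherwise
  \<open>d k \<ge> \<mu>\<close> (\<open>V_escape\<close>). In both cases every partial bijection with domain inside \<open>Range k\<close>
  lies in \<open>V\<close>, and \<open>h = k O (k\<inverse> O h)\<close> exhibits an arbitrary \<open>h\<close> as a product. With inverses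
  available, \<open>h = k O (k\<inverse> O h O k) O k\<inverse>\<close> does the same inside \<open>V \<inter> V\<inverse>\<close>.

  \<^emph>\<open>There are no others.\<close> For \<open>A\<close> infinite or a singleton, the partial bijections with
  \<open>c f \<ge> |A|\<close> or \<open>d f < |A|\<close> form a proper subsemigroup that contains \<open>Sym X\<close>, so a maximal
  subsemigroup \<open>M\<close> without \<open>Sym X\<close> is not inside any of them. Suppose that \<open>M\<close> is not inside any
  \<open>V\<close> either. Induction on \<open>|A|\<close> shows that \<open>M\<close> contains total maps of defect at least
  \<open>|A|\<close> for all \<open>A \<subseteq> X\<close>: if \<open>f \<in> M\<close> has \<open>c f < |A| \<le> d f\<close>, a total \<open>p \<in> M\<close>
  with \<open>d p \<ge> c f\<close> is provided by the induction hypothesis, and an element of the stabiliser moves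
  \<open>Range p\<close> into \<open>Domain f\<close>. The move is blocked only if \<open>Domain f \<notin> F\<close> while
  \<open>Range p \<in> F\<close>; then \<open>m < |A|\<close>, and an element of \<open>M\<close> outside \<open>V\<close> for \<open>\<mu> = |A|\<close> either
  replaces \<open>f\<close> or changes \<open>p\<close> so that its range leaves \<open>F\<close>
  (\<open>exists_total_defect_ge_step\<close>). At the end \<open>M\<close> contains a total \<open>p\<close> with
  \<open>Range p \<notin> F\<close> and \<open>d p = |X|\<close>. If \<open>M\<close> is not inside any \<open>V\<inverse>\<close>, it dually contains
  a surjective \<open>q\<close> with \<open>Domain q \<notin> F\<close> and \<open>c q = |X|\<close>. For a permutation \<open>b\<close> the map
  \<open>p\<inverse> O b O q\<inverse>\<close> extends to an element \<open>t\<close> of the stabiliser, and \<open>b = p O t O q\<close>.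
  So \<open>M\<close> contains \<open>Sym X\<close> after all (\<open>rich_semigroup_pair_contains_Sym\<close>).
\<close>

section \<open>Cardinals of sets\<close>

lemma infinite_split:
  assumes "infinite A"
  shows "\<exists>B C. A = B \<union> C \<and> B \<inter> C = {} \<and> |B| =o |A| \<and> |C| =o |A|"
proof -
  have "|A <+> A| =o |A|"
    using assms by (rule card_of_Plus_infinite[OF _ ordLeq_refl[OF card_of_Card_order], THEN conjunct1])
  then obtain h where h: "bij_betw h (A <+> A) A"
    using card_of_ordIso by blast
  let ?B = "(h \<circ> Inl) ` A" and ?C = "(h \<circ> Inr) ` A"
  have inj: "inj_on h (A <+> A)" and img: "h ` (A <+> A) = A"
    using h by (auto simp: bij_betw_def)
  have "A = ?B \<union> ?C"
    using img by (auto simp: Plus_def image_Un image_comp)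
  moreover have "?B \<inter> ?C = {}"
    using inj by (auto simp: inj_on_def Plus_def)
  moreover have "inj_on (h \<circ> Inl) A" "inj_on (h \<circ> Inr) A"
    using inj by (auto simp: inj_on_def Plus_def)
  then have "|?B| =o |A|" "|?C| =o |A|"
    by (meson card_of_ordIsoI inj_on_imp_bij_betw ordIso_symmetric)+
  ultimately show ?thesis by blast
qed

text \<open>
  A bijection from \<open>C - E\<close> to \<open>C\<close> extends by the identity on \<open>Y - C\<close>.
\<close>

lemma card_of_Diff_superset:
  assumes "E \<subseteq> C" and "C \<subseteq> Y" and "|C - E| =o |C|"
  shows "|Y - E| =o |Y|"
proof -
  obtain g where g: "bij_betw g (C - E) C"
    using assms(3) card_of_ordIso by blast
  have "bij_betw (\<lambda>y. y) (Y - C) (Y - C)"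
    by (simp add: bij_betw_def)
  from bij_betw_disjoint_Un[OF g this] have
    "bij_betw (\<lambda>y. if y \<in> C - E then g y else y) ((C - E) \<union> (Y - C)) (C \<union> (Y - C))"
    by blast
  moreover have "(C - E) \<union> (Y - C) = Y - E" "C \<union> (Y - C) = Y"
    using assms(1,2) by auto
  ultimately show ?thesis
    using card_of_ordIsoI by metis
qed

lemma exists_subset_of_card:
  assumes "|K| \<le>o |Z|"
  shows "\<exists>A\<subseteq>Z. |A| =o |K|"
proof -
  obtain h where "inj_on h K" "h ` K \<subseteq> Z"
    using assms card_of_ordLeq by metis
  moreover from this have "|h ` K| =o |K|"
    by (meson card_of_ordIsoI inj_on_imp_bij_betw ordIso_symmetric)
  ultimately show ?thesis by blast
qed

lemma card_of_Un_ordLeq_infinite: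
  assumes "infinite C" "|A| \<le>o |C|" "|B| \<le>o |C|"
  shows "|A \<union> B| \<le>o |C|"
  by (rule card_of_Un_ordLeq_infinite_Field[OF _ assms(2,3) card_of_Card_order])
    (simp add: assms(1) Field_card_of)

lemma card_of_Diff_infinite:
  assumes "infinite A" "|B| <o |A|"
  shows "|A - B| =o |A|"
proof -
  have "\<not> |A - B| <o |A|"
  proof
    assume "|A - B| <o |A|"
    then have "|(A - B) \<union> B| <o |A|"
      using assms by (intro card_of_Un_ordLess_infinite)
    moreover have "|A| \<le>o |(A - B) \<union> B|"
      by (rule card_of_mono1) blast
    ultimately show False
      using not_ordLess_ordLeq by blast
  qed
  moreover have "|A - B| \<le>o |A|"
    by (rule card_of_mono1) blast
  ultimately show ?thesis
    using ordLeq_iff_ordLess_or_ordIso by blast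
qed

section \<open>Partial bijections\<close>

lemma sym_inv_monoid_converse [simp]: "f\<inverse> \<in> sym_inv_monoid X \<longleftrightarrow> f \<in> sym_inv_monoid X"
  by (auto simp: sym_inv_monoid_def)

lemma sym_inv_monoid_comp:
  "f \<in> sym_inv_monoid X \<Longrightarrow> g \<in> sym_inv_monoid X \<Longrightarrow> f O g \<in> sym_inv_monoid X"
  by (auto simp: sym_inv_monoid_def converse_relcomp intro: single_valued_relcomp)

lemma sym_inv_monoid_D:
  assumes "f \<in> sym_inv_monoid X"
  shows "f \<subseteq> X \<times> X" "Domain f \<subseteq> X" "Range f \<subseteq> X" "f `` S \<subseteq> X"
    "(x, y) \<in> f \<Longrightarrow> (x, z) \<in> f \<Longrightarrow> y = z"
    "(x, z) \<in> f \<Longrightarrow> (y, z) \<in> f \<Longrightarrow> x = y"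
  using assms by (auto simp: sym_inv_monoid_def single_valued_def)

lemma sym_inv_monoid_Un:
  assumes "f \<in> sym_inv_monoid X" "g \<in> sym_inv_monoid X"
    and "Domain f \<inter> Domain g = {}" "Range f \<inter> Range g = {}"
  shows "f \<union> g \<in> sym_inv_monoid X"
proof -
  have "f \<union> g \<subseteq> X \<times> X"
    using assms(1,2) by (auto simp: sym_inv_monoid_def)
  moreover have "single_valued (f \<union> g)"
    by (rule single_valuedI) (use assms(3) sym_inv_monoid_D(5)[OF assms(1)]
        sym_inv_monoid_D(5)[OF assms(2)] in auto)
  moreover have "single_valued ((f \<union> g)\<inverse>)"
    by (rule single_valuedI) (use assms(4) sym_inv_monoid_D(6)[OF assms(1)]
        sym_inv_monoid_D(6)[OF assms(2)] in auto)
  ultimately show ?thesis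
    by (simp add: sym_inv_monoid_def)
qed

lemma sym_inv_monoid_Id_on: "E \<subseteq> X \<Longrightarrow> Id_on E \<in> sym_inv_monoid X"
  by (auto simp: sym_inv_monoid_def single_valued_def)

lemma Id_on_Sym: "Id_on X \<in> Sym X"
  by (simp add: Sym_def sym_inv_monoid_Id_on)

lemma exists_partial_bijection:
  assumes "P \<subseteq> X" "Q \<subseteq> X" and "|P| =o |Q|"
  shows "\<exists>f\<in>sym_inv_monoid X. Domain f = P \<and> Range f = Q"
proof -
  obtain h where h: "bij_betw h P Q"
    using assms(3) card_of_ordIso by blast
  let ?f = "{(x, h x) | x. x \<in> P}"
  have "?f \<in> sym_inv_monoid X"
    using h assms(1,2) by (auto simp: sym_inv_monoid_def single_valued_def bij_betw_def inj_on_def)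
  moreover have "Domain ?f = P" "Range ?f = Q"
    using h by (auto simp: bij_betw_def)
  ultimately show ?thesis by blast
qed

lemma card_of_Image:
  assumes "f \<in> sym_inv_monoid X"
  shows "|f `` A| \<le>o |A|"
proof -
  have "f `` A \<subseteq> (\<lambda>x. THE y. (x, y) \<in> f) ` A"
  proof
    fix y assume "y \<in> f `` A"
    then obtain x where x: "x \<in> A" "(x, y) \<in> f" by blast
    then have "(THE y. (x, y) \<in> f) = y"
      using sym_inv_monoid_D(5)[OF assms] by blast
    with x show "y \<in> (\<lambda>x. THE y. (x, y) \<in> f) ` A" by force
  qed
  then show ?thesis
    using card_of_image card_of_mono1 ordLeq_transitive by blast
qed

lemma converse_Image_Image:
  assumes "f \<in> sym_inv_monoid X" "A \<subseteq> Domain f"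
  shows "f\<inverse> `` (f `` A) = A"
  using assms(2) sym_inv_monoid_D(6)[OF assms(1)] by blast

lemma Image_converse_Image:
  assumes "f \<in> sym_inv_monoid X" "A \<subseteq> Range f"
  shows "f `` (f\<inverse> `` A) = A"
  using assms(2) sym_inv_monoid_D(5)[OF assms(1)] by blast

lemma card_of_Image_Domain:
  assumes "f \<in> sym_inv_monoid X" "A \<subseteq> Domain f"
  shows "|f `` A| =o |A|"
proof -
  have "|f\<inverse> `` (f `` A)| \<le>o |f `` A|"
    by (rule card_of_Image) (use assms in simp)
  then show ?thesis
    unfolding converse_Image_Image[OF assms]
    using card_of_Image[OF assms(1)] ordIso_iff_ordLeq by blast
qed

lemma card_of_Range:
  assumes "f \<in> sym_inv_monoid X"
  shows "|Range f| =o |Domain f|"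
proof -
  have "f `` Domain f = Range f" by blast
  then show ?thesis
    using card_of_Image_Domain[OF assms subset_refl] by simp
qed

lemma Image_Diff:
  assumes "f \<in> sym_inv_monoid X"
  shows "f `` (A - B) = f `` A - f `` B"
  using sym_inv_monoid_D(6)[OF assms] by blast

lemma collapse_comp_le: "|X - Domain f| \<le>o |X - Domain (f O g)|"
  by (rule card_of_mono1) blast

text \<open>
  A point where \<open>g\<close> is undefined is either missed by \<open>f\<close> or the image of a point where \<open>f O g\<close> is
  undefined. Hence \<open>c(g) \<le> d(f) + c(f O g)\<close>, which is why a large collapse of the right factor
  survives composition with a map of small defect.
\<close>

lemma collapse_right_subset:
  assumes "f \<in> sym_inv_monoid X"
  shows "X - Domain g \<subseteq> (X - Range f) \<union> f `` (X - Domain (f O g))"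
proof
  fix y assume y: "y \<in> X - Domain g"
  show "y \<in> (X - Range f) \<union> f `` (X - Domain (f O g))"
  proof (cases "y \<in> Range f")
    case True
    then obtain x where x: "(x, y) \<in> f" by blast
    then have "x \<in> X" "x \<notin> Domain (f O g)"
      using y sym_inv_monoid_D(2,5)[OF assms] by blast+
    then show ?thesis using x by blast
  qed (use y in blast)
qed

lemma defect_comp_subset:
  "X - Range (f O g) \<subseteq> (X - Range g) \<union> g `` (X - Range f)" if "g \<in> sym_inv_monoid X"
  using sym_inv_monoid_D(1)[OF that] by blast

lemma defect_comp_ge:
  assumes "f \<in> sym_inv_monoid X" "g \<in> sym_inv_monoid X" "Domain g = X"
  shows "|X - Range f| \<le>o |X - Range (f O g)|"
proof -
  have "g `` (X - Range f) \<subseteq> X - Range (f O g)"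
    using sym_inv_monoid_D[OF assms(2)] by blast
  moreover have "|g `` (X - Range f)| =o |X - Range f|"
    using assms by (intro card_of_Image_Domain) auto
  ultimately show ?thesis
    by (meson card_of_mono1 ordIso_ordLeq_trans ordIso_symmetric)
qed

lemma preserves_comp:
  assumes "preserves X F f" "preserves X F g" "f \<in> sym_inv_monoid X"
  shows "preserves X F (f O g)"
  using assms(1,2) sym_inv_monoid_D(4)[OF assms(3)] unfolding preserves_def relcomp_Image by metis

lemma Sym_converse: "f \<in> Sym X \<Longrightarrow> f\<inverse> \<in> Sym X"
  by (simp add: Sym_def)

section \<open>Non-principal ultrafilters\<close>

locale free_ultrafilter =
  fixes X :: "'a set" and F :: "'a set set"
  assumes infinite_X: "infinite X"
    and ultrafilter: "ultrafilter_on X F"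
    and nonprincipal: "nonprincipal X F"
begin

abbreviation I :: "'a rel set" where "I \<equiv> sym_inv_monoid X"

lemma F_subset: "A \<in> F \<Longrightarrow> A \<subseteq> X"
  and X_in_F: "X \<in> F"
  and empty_notin_F: "{} \<notin> F"
  and F_Int: "A \<in> F \<Longrightarrow> B \<in> F \<Longrightarrow> A \<inter> B \<in> F"
  and F_superset: "A \<in> F \<Longrightarrow> A \<subseteq> B \<Longrightarrow> B \<subseteq> X \<Longrightarrow> B \<in> F"
  using ultrafilter by (auto simp: ultrafilter_on_def filter_on_def)

lemma F_disjoint: "A \<in> F \<Longrightarrow> A \<inter> B = {} \<Longrightarrow> B \<notin> F"
  using F_Int empty_notin_F by metis

lemma F_compl: "A \<subseteq> X \<Longrightarrow> X - A \<in> F \<longleftrightarrow> A \<notin> F"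
  using ultrafilter F_disjoint[of A "X - A"] by (auto simp: ultrafilter_on_def)

lemma F_Diff: "A \<in> F \<Longrightarrow> B \<notin> F \<Longrightarrow> B \<subseteq> X \<Longrightarrow> A - B \<in> F"
  using F_Int[of A "X - B"] F_compl[of B] F_subset[of A] by (simp add: Diff_eq Int_absorb2 Int_assoc[symmetric])

lemma F_Un: "A \<union> B \<in> F \<Longrightarrow> A \<in> F \<or> B \<in> F"
  using F_Diff[of "A \<union> B" A] F_superset[of "A \<union> B - A" B] F_subset[of "A \<union> B"] by blast

lemma F_infinite: "A \<in> F \<Longrightarrow> infinite A"
proof
  assume "finite A" "A \<in> F"
  moreover have "finite A \<Longrightarrow> A \<notin> F"
  proof (induction A rule: finite_induct)
    case (insert x A)
    show ?case
    proof
      assume ins: "insert x A \<in> F"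
      then have x: "{x} \<in> F"
        using F_Un[of "{x}" A] insert.IH by simp
      have "F = {S. S \<subseteq> X \<and> x \<in> S}"
        using F_superset[OF x] F_disjoint[OF x] F_subset by auto
      then show False
        using nonprincipal F_subset[OF x] by (auto simp: nonprincipal_def)
    qed
  qed (use empty_notin_F in simp)
  ultimately show False by blast
qed

text \<open>
  This makes the choice in the definition of \<open>min_card\<close> accessible: the minimum is attained.
\<close>

lemma exists_min_card: "\<exists>C\<in>F. min_card F = |C| \<and> (\<forall>T\<in>F. |C| \<le>o |T| )"
proof -
  have "\<exists>S. S \<in> F \<and> (\<forall>T\<in>F. |S| \<le>o |T| )"
    using exists_minim_Well_order[of "card_of ` F"] X_in_F by (auto intro: card_of_Well_order)
  from someI_ex[OF this] show ?thesis
    unfolding min_card_def by blast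
qed

lemma min_card_le: "A \<in> F \<Longrightarrow> min_card F \<le>o |A|"
  using exists_min_card by metis

lemma F_small_subset:
  assumes "A \<in> F"
  shows "\<exists>E\<in>F. E \<subseteq> A \<and> |E| \<le>o min_card F"
proof -
  obtain C where "C \<in> F" "min_card F = |C|"
    using exists_min_card by blast
  then show ?thesis
    using F_Int[OF assms, of C] card_of_mono1[of "A \<inter> C" C] by (metis inf_le1 inf_le2)
qed

text \<open>
  Of the two halves of \<open>C\<close>, one belongs to \<open>F\<close>; the other half provides the room in which
  permutations fixing a set of \<open>F\<close> can be built.
\<close>

lemma F_shrink:
  assumes "C \<in> F"
  shows "\<exists>E\<in>F. E \<subseteq> C \<and> |C - E| =o |C|"
proof -
  obtain B D where BD: "C = B \<union> D" "B \<inter> D = {}" "|B| =o |C|" "|D| =o |C|"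
    using infinite_split[OF F_infinite[OF assms]] by blast
  then have "C - B = D" "C - D = B"
    by auto
  then show ?thesis
    using F_Un[of B D] assms BD by auto
qed

lemma preserves_if_Id_on:
  assumes "t \<in> I" "E \<in> F" "Id_on E \<subseteq> t"
  shows "preserves X F t"
  unfolding preserves_def
proof (intro allI impI iffI)
  fix S assume "S \<subseteq> X" "S \<in> F"
  then have "S \<inter> E \<in> F"
    using F_Int assms(2) by blast
  moreover have "S \<inter> E \<subseteq> t `` S"
    using assms(3) by blast
  ultimately show "t `` S \<in> F"
    using F_superset sym_inv_monoid_D(4)[OF assms(1)] by blast
next
  fix S assume S: "S \<subseteq> X" "t `` S \<in> F"
  then have "t `` S \<inter> E \<in> F"
    using F_Int assms(2) by blast
  moreover have "t `` S \<inter> E \<subseteq> S"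
  proof
    fix y assume "y \<in> t `` S \<inter> E"
    then obtain x where x: "x \<in> S" "(x, y) \<in> t" "(y, y) \<in> t"
      using assms(3) by blast
    then show "y \<in> S"
      using sym_inv_monoid_D(6)[OF assms(1) x(2,3)] by simp
  qed
  ultimately show "S \<in> F"
    using F_superset S(1) by blast
qed

text \<open>
  The points outside \<open>Domain h \<union> Range h\<close> form a set of \<open>F\<close>. A subset \<open>E \<in> F\<close> of them is fixed
  pointwise, and \<open>E\<close> is thin enough for the remaining complements of domain and range to stay
  equinumerous, so that a bijection between them completes the permutation.
\<close>

lemma extend_to_stabiliser:
  assumes h: "h \<in> I" and dom: "Domain h \<notin> F" and ran: "Range h \<notin> F"
    and card: "|X - Domain h| =o |X - Range h|"
  shows "\<exists>t\<in>filter_stabiliser X F. h \<subseteq> t"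
proof -
  note [simp] = sym_inv_monoid_D(2,3)[OF h]
  have "(X - Domain h) \<inter> (X - Range h) \<in> F"
    using dom ran by (intro F_Int) (simp_all add: F_compl)
  then obtain E where E: "E \<in> F" "E \<subseteq> (X - Domain h) \<inter> (X - Range h)"
    "|(X - Domain h) \<inter> (X - Range h) - E| =o |(X - Domain h) \<inter> (X - Range h)|"
    using F_shrink by blast
  have "|X - Domain h - E| =o |X - Domain h|" "|X - Range h - E| =o |X - Range h|"
    by (rule card_of_Diff_superset[OF E(2) _ E(3)]; blast)+
  then have "|X - Domain h - E| =o |X - Range h - E|"
    using card ordIso_transitive ordIso_symmetric by meson
  then obtain k where k: "k \<in> I" "Domain k = X - Domain h - E" "Range k = X - Range h - E"
    using exists_partial_bijection[of "X - Domain h - E" X "X - Range h - E"] by blast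
  define t where "t = (h \<union> Id_on E) \<union> k"
  have "E \<subseteq> X"
    using E(1) F_subset by blast
  have hE: "h \<union> Id_on E \<in> I"
    using E(2) by (intro sym_inv_monoid_Un h sym_inv_monoid_Id_on \<open>E \<subseteq> X\<close>) auto
  have "t \<in> I"
    unfolding t_def by (rule sym_inv_monoid_Un[OF hE k(1)]; unfold k(2,3); blast)
  moreover have "Domain t = X" "Range t = X"
    unfolding t_def Domain_Un_eq Range_Un_eq Domain_Id_on Range_Id_on k(2,3)
    using \<open>E \<subseteq> X\<close> sym_inv_monoid_D(2,3)[OF h] by blast+
  moreover have "preserves X F t"
    by (rule preserves_if_Id_on[OF \<open>t \<in> I\<close> E(1)]) (use t_def in blast)
  ultimately have "t \<in> filter_stabiliser X F"
    by (simp add: filter_stabiliser_def Sym_def)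
  moreover have "h \<subseteq> t"
    unfolding t_def by blast
  ultimately show ?thesis
    by blast
qed

text \<open>
  Used to make a partial bijection total by composing with a harmless map on the left: \<open>s\<close> is the
  identity on a thinned set of \<open>F\<close> and an arbitrary bijection elsewhere.
\<close>

lemma exists_total_onto:
  assumes "D \<in> F" and "|D| =o |X|"
  shows "\<exists>s\<in>I. preserves X F s \<and> Domain s = X \<and> Range s = D"
proof -
  obtain E where E: "E \<in> F" "E \<subseteq> D" "|D - E| =o |D|"
    using F_shrink[OF assms(1)] by blast
  have DX: "D \<subseteq> X"
    by (rule F_subset[OF assms(1)])
  have "|X - E| =o |X|"
    by (rule card_of_Diff_superset[OF E(2) DX E(3)])
  also have "|X| =o |D|"
    by (rule ordIso_symmetric[OF assms(2)])
  also have "|D| =o |D - E|"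
    by (rule ordIso_symmetric[OF E(3)])
  finally obtain k where k: "k \<in> I" "Domain k = X - E" "Range k = D - E"
    using exists_partial_bijection[of "X - E" X "D - E"] DX by blast
  have EX: "E \<subseteq> X"
    using E(2) DX by blast
  have s: "Id_on E \<union> k \<in> I"
    using k by (intro sym_inv_monoid_Un sym_inv_monoid_Id_on EX) auto
  have "Domain (Id_on E \<union> k) = X" "Range (Id_on E \<union> k) = D"
    unfolding Domain_Un_eq Range_Un_eq Domain_Id_on Range_Id_on k(2,3)
    using EX E(2) by blast+
  with s preserves_if_Id_on[OF s E(1)] show ?thesis
    by blast
qed

lemma preserves_Domain_Range:
  assumes "preserves X F f" "f \<in> I"
  shows "Domain f \<in> F" "Range f \<in> F"
proof -
  have "f `` X = Range f" "f `` Domain f = Range f"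
    using sym_inv_monoid_D(2)[OF assms(2)] by blast+
  then show "Range f \<in> F" "Domain f \<in> F"
    using assms X_in_F sym_inv_monoid_D(2)[OF assms(2)] unfolding preserves_def by auto
qed

lemma preserves_converse:
  assumes "preserves X F f" "f \<in> I"
  shows "preserves X F (f\<inverse>)"
  unfolding preserves_def
proof (intro allI impI)
  fix S assume "S \<subseteq> X"
  have "f\<inverse> `` S \<subseteq> X"
    using sym_inv_monoid_D(4)[of "f\<inverse>" X S] assms(2) by simp
  then have "f\<inverse> `` S \<in> F \<longleftrightarrow> f `` (f\<inverse> `` S) \<in> F"
    using assms(1) unfolding preserves_def by blast
  also have "f `` (f\<inverse> `` S) = S \<inter> Range f"
    using Image_converse_Image[OF assms(2), of "S \<inter> Range f"] by blast
  also have "S \<inter> Range f \<in> F \<longleftrightarrow> S \<in> F"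
    using F_Int[of S "Range f"] preserves_Domain_Range(2)[OF assms] F_superset \<open>S \<subseteq> X\<close> by blast
  finally show "S \<in> F \<longleftrightarrow> f\<inverse> `` S \<in> F" by simp
qed

lemma preserves_converse_iff: "f \<in> I \<Longrightarrow> preserves X F (f\<inverse>) \<longleftrightarrow> preserves X F f"
  using preserves_converse[of f] preserves_converse[of "f\<inverse>"] by auto

lemma filter_stabiliser_converse: "f \<in> filter_stabiliser X F \<Longrightarrow> f\<inverse> \<in> filter_stabiliser X F"
  unfolding filter_stabiliser_def using Sym_converse preserves_converse by (auto simp: Sym_def)

text \<open>
  Some \<open>S \<in> F\<close> inside the domain has its image outside \<open>F\<close>. The whole domain serves as \<open>D\<close> if
  \<open>Range f \<notin> F\<close>. Otherwise \<open>Range f - f `` S\<close> is in \<open>F\<close> and contains a set \<open>C \<in> F\<close> of minimal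
  cardinality. It suffices to delete the preimage of \<open>C\<close> from the domain, because \<open>f `` D\<close> then
  misses \<open>C\<close>. The set deleted has at most \<open>min_card F\<close> points, and it is here that the condition
  \<open>min(F) < \<mu>\<close> comes from.
\<close>

lemma not_preserves_witness:
  assumes f: "f \<in> I" and dom: "Domain f \<in> F" and np: "\<not> preserves X F f"
    and rank: "|Range f| =o |X|"
  shows "\<exists>D\<in>F. D \<subseteq> Domain f \<and> f `` D \<notin> F \<and> |D| =o |X| \<and> |Domain f - D| \<le>o min_card F"
proof (cases "Range f \<in> F")
  case False
  have "f `` Domain f = Range f"
    by blast
  moreover have "|Domain f| =o |X|"
    using card_of_Range[OF f] rank by (meson ordIso_symmetric ordIso_transitive)
  moreover have "|Domain f - Domain f| \<le>o min_card F"
    using exists_min_card by (auto intro: card_of_empty)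
  ultimately show ?thesis
    using dom False by (intro bexI[of _ "Domain f"]) auto
next
  case ran: True
  have "\<exists>S\<in>F. S \<subseteq> Domain f \<and> f `` S \<notin> F"
  proof -
    obtain S where S: "S \<subseteq> X" "(S \<in> F) \<noteq> (f `` S \<in> F)"
      using np unfolding preserves_def by blast
    show ?thesis
    proof (cases "S \<in> F")
      case True
      have "f `` (S \<inter> Domain f) = f `` S" by blast
      then show ?thesis
        using True S(2) F_Int[OF True dom] by (metis inf_le2)
    next
      case False
      then have "f `` S \<inter> f `` (Domain f - S) = {}"
        unfolding Image_Diff[OF f] by blast
      then have "f `` (Domain f - S) \<notin> F"
        using S(2) False F_disjoint by blast
      then show ?thesis
        using F_Diff[OF dom False S(1)] by blast
    qed
  qed
  then obtain S where S: "S \<in> F" "S \<subseteq> Domain f" "f `` S \<notin> F"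
    by blast
  have "Range f - f `` S \<in> F"
    using F_Diff[OF ran S(3)] sym_inv_monoid_D(4)[OF f] by blast
  then obtain C0 where C0: "C0 \<in> F" "C0 \<subseteq> Range f - f `` S" "|C0| \<le>o min_card F"
    using F_small_subset by blast
  \<comment> \<open>Thinning \<open>C0\<close> guarantees that \<open>Range f - C\<close> still has cardinality \<open>|X|\<close>.\<close>
  then obtain C where C: "C \<in> F" "C \<subseteq> C0" "|C0 - C| =o |C0|"
    using F_shrink by blast
  let ?D = "Domain f - f\<inverse> `` C"
  have "S \<subseteq> ?D"
    using C(2) C0(2) S(2) by blast
  then have "?D \<in> F"
    using F_superset[OF S(1)] F_subset[OF dom] by blast
  moreover have imD: "f `` ?D = Range f - C"
    using Image_converse_Image[OF f, of C] C(2) C0(2) unfolding Image_Diff[OF f] by blast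
  then have "f `` ?D \<notin> F"
    using F_disjoint[OF C(1)] by blast
  moreover have "|?D| =o |X|"
  proof -
    have "|?D| =o |f `` ?D|"
      by (rule ordIso_symmetric, rule card_of_Image_Domain[OF f]) blast
    also have "|f `` ?D| =o |Range f|"
      unfolding imD using C0(2) by (intro card_of_Diff_superset[OF C(2) _ C(3)]) blast
    also note rank
    finally show ?thesis .
  qed
  moreover have "|Domain f - ?D| \<le>o min_card F"
  proof -
    have "|Domain f - ?D| \<le>o |f\<inverse> `` C|"
      by (rule card_of_mono1) blast
    also have "|f\<inverse> `` C| \<le>o |C|"
      by (rule card_of_Image) (use f in simp)
    also have "|C| \<le>o |C0|"
      by (rule card_of_mono1[OF C(2)])
    also note C0(3)
    finally show ?thesis .
  qed
  ultimately show ?thesis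
    by blast
qed

section \<open>The semigroups \<open>V\<close>\<close>

lemma filter_cardinals_D:
  assumes "\<mu> \<in> filter_cardinals X F"
  shows "Card_order \<mu>" "infinite (Field \<mu>)" "min_card F <o \<mu>" "\<mu> \<le>o cardSuc |X|"
proof -
  show *: "Card_order \<mu>" "min_card F <o \<mu>" "\<mu> \<le>o cardSuc |X|"
    using assms by (auto simp: filter_cardinals_def)
  obtain C where C: "C \<in> F" "min_card F = |C|"
    using exists_min_card by blast
  have "|C| \<le>o |Field \<mu>|"
    using *(2) card_of_Field_ordIso[OF *(1)] unfolding C(2)
    by (meson ordIso_symmetric ordLess_imp_ordLeq ordLeq_ordIso_trans)
  then show "infinite (Field \<mu>)"
    using card_of_ordLeq_finite F_infinite[OF C(1)] by blast
qed

lemma not_ordLess_card_of: "Card_order \<mu> \<Longrightarrow> \<not> |A| <o \<mu> \<longleftrightarrow> \<mu> \<le>o |A|"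
  by (rule not_ordLess_iff_ordLeq) (simp_all add: card_order_on_def card_of_Well_order)

lemma not_ordLeq_card_of: "Card_order \<mu> \<Longrightarrow> \<not> \<mu> \<le>o |A| \<longleftrightarrow> |A| <o \<mu>"
  by (rule not_ordLeq_iff_ordLess) (simp_all add: card_order_on_def card_of_Well_order)

lemma cardSuc_in_filter_cardinals: "cardSuc |X| \<in> filter_cardinals X F"
proof -
  have "min_card F <o cardSuc |X|"
    using min_card_le[OF X_in_F] cardSuc_greater[OF card_of_Card_order] ordLeq_ordLess_trans by blast
  then show ?thesis
    by (simp add: filter_cardinals_def cardSuc_Card_order card_of_Card_order ordLeq_refl)
qed

lemma filter_stabiliser_D:
  assumes "f \<in> filter_stabiliser X F"
  shows "f \<in> I" "Domain f = X" "Range f = X" "preserves X F f"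
  using assms by (auto simp: filter_stabiliser_def Sym_def)

lemma small_rank_comp:
  assumes "f \<in> small_rank X" "g \<in> I"
  shows "f O g \<in> small_rank X" "g O f \<in> small_rank X"
proof -
  have f: "f \<in> I" "|Range f| <o |X|"
    using assms(1) by (auto simp: small_rank_def rank_def)
  have "|Range (f O g)| \<le>o |g `` Range f|"
    by (rule card_of_mono1) blast
  also have "|g `` Range f| \<le>o |Range f|"
    by (rule card_of_Image[OF assms(2)])
  finally have "|Range (f O g)| <o |X|"
    using f(2) ordLeq_ordLess_trans by blast
  then show "f O g \<in> small_rank X"
    using f(1) assms(2) by (simp add: small_rank_def rank_def sym_inv_monoid_comp)
  have "|Range (g O f)| \<le>o |Range f|"
    by (rule card_of_mono1) blast
  then have "|Range (g O f)| <o |X|"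
    using f(2) ordLeq_ordLess_trans by blast
  then show "g O f \<in> small_rank X"
    using f(1) assms(2) by (simp add: small_rank_def rank_def sym_inv_monoid_comp)
qed

lemma small_rank_converse:
  assumes "f \<in> small_rank X"
  shows "f\<inverse> \<in> small_rank X"
proof -
  have "f \<in> I" "|Range f| <o |X|"
    using assms by (auto simp: small_rank_def rank_def)
  then have "|Domain f| <o |X|"
    using card_of_Range ordIso_ordLess_trans ordIso_symmetric by blast
  then show ?thesis
    using \<open>f \<in> I\<close> by (simp add: small_rank_def rank_def)
qed

lemma small_rank_not_small:
  assumes "f \<in> I"
  shows "f \<notin> small_rank X \<longleftrightarrow> |Range f| =o |X|"
proof -
  have "|Range f| \<le>o |X|"
    using sym_inv_monoid_D(3)[OF assms] by (rule card_of_mono1)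
  then show ?thesis
    using assms not_ordLess_ordIso ordLeq_iff_ordLess_or_ordIso
    unfolding small_rank_def rank_def by blast
qed

text \<open>
  The cardinal \<open>\<mu>\<close> enters only through the additivity property \<open>add\<close>, which every infinite cardinal
  has, but also \<open>\<mu> = 1\<close>. The same lemma thus serves both the semigroups \<open>V\<close> and the semigroups
  containing the symmetric group that are considered later.
\<close>

lemma collapse_comp_ge:
  assumes f: "f \<in> I" and \<mu>: "Card_order \<mu>"
    and add: "\<And>A B :: 'a set. |A| <o \<mu> \<Longrightarrow> |B| <o \<mu> \<Longrightarrow> |A \<union> B| <o \<mu>"
    and df: "|X - Range f| <o \<mu>" and cg: "\<mu> \<le>o |X - Domain g|"
  shows "\<mu> \<le>o |X - Domain (f O g)|"
proof (rule ccontr)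
  assume "\<not> \<mu> \<le>o |X - Domain (f O g)|"
  then have "|X - Domain (f O g)| <o \<mu>"
    using \<mu> by (simp add: not_ordLeq_card_of)
  then have "|f `` (X - Domain (f O g))| <o \<mu>"
    using card_of_Image[OF f] ordLeq_ordLess_trans by blast
  with df have "|(X - Range f) \<union> f `` (X - Domain (f O g))| <o \<mu>"
    by (rule add)
  then have "|X - Domain g| <o \<mu>"
    using card_of_mono1[OF collapse_right_subset[OF f]] ordLeq_ordLess_trans by blast
  then show False
    using cg \<mu> not_ordLeq_card_of by blast
qed

lemma defect_comp_less:
  assumes g: "g \<in> I"
    and add: "\<And>A B :: 'a set. |A| <o \<mu> \<Longrightarrow> |B| <o \<mu> \<Longrightarrow> |A \<union> B| <o \<mu>"
    and df: "|X - Range f| <o \<mu>" and dg: "|X - Range g| <o \<mu>"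
  shows "|X - Range (f O g)| <o \<mu>"
proof -
  have "|g `` (X - Range f)| <o \<mu>"
    using card_of_Image[OF g] df ordLeq_ordLess_trans by blast
  with dg have "|(X - Range g) \<union> g `` (X - Range f)| <o \<mu>"
    by (rule add)
  then show ?thesis
    using card_of_mono1[OF defect_comp_subset[OF g]] ordLeq_ordLess_trans by blast
qed

lemma V_iff:
  "f \<in> V X F \<mu> \<longleftrightarrow> f \<in> I \<and> (\<mu> \<le>o |X - Domain f| \<or> Domain f \<notin> F \<or>
     (preserves X F f \<and> |X - Range f| <o \<mu>) \<or> f \<in> small_rank X)"
  by (auto simp: V_def collapse_def defect_def small_rank_def)

lemma not_in_V_D:
  assumes \<mu>: "\<mu> \<in> filter_cardinals X F" and f: "f \<in> I" "f \<notin> V X F \<mu>"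
  shows "|X - Domain f| <o \<mu>" "Domain f \<in> F" "|Range f| =o |X|"
    "\<not> preserves X F f \<or> \<mu> \<le>o |X - Range f|"
  using f filter_cardinals_D(1)[OF \<mu>] small_rank_not_small[OF f(1)]
  by (auto simp: V_iff not_ordLeq_card_of not_ordLess_card_of)

lemma V_subsemigroup:
  assumes "\<mu> \<in> filter_cardinals X F"
  shows "subsemigroup X (V X F \<mu>)"
  unfolding subsemigroup_def
proof (intro conjI ballI)
  show "V X F \<mu> \<subseteq> I"
    by (auto simp: V_iff)
next
  note \<mu> = filter_cardinals_D[OF assms]
  have add: "|A| <o \<mu> \<Longrightarrow> |B| <o \<mu> \<Longrightarrow> |A \<union> B| <o \<mu>" for A B :: "'a set"
    by (rule card_of_Un_ordLess_infinite_Field[OF \<mu>(2,1)])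
  fix f g assume fV: "f \<in> V X F \<mu>" and gV: "g \<in> V X F \<mu>"
  then have f: "f \<in> I" and g: "g \<in> I"
    by (auto simp: V_iff)
  have fg: "f O g \<in> I"
    by (rule sym_inv_monoid_comp[OF f g])
  have Dfg: "Domain (f O g) \<subseteq> Domain f"
    by blast
  show "f O g \<in> V X F \<mu>"
  proof (cases "\<mu> \<le>o |X - Domain f| \<or> Domain f \<notin> F \<or> f \<in> small_rank X \<or> g \<in> small_rank X")
    case True
    then consider "\<mu> \<le>o |X - Domain f|" | "Domain f \<notin> F" | "f O g \<in> small_rank X"
      using small_rank_comp f g by blast
    then show ?thesis
    proof cases
      case 1
      then have "\<mu> \<le>o |X - Domain (f O g)|"
        using collapse_comp_le ordLeq_transitive by blast
      then show ?thesis
        using fg by (simp add: V_iff)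
    next
      case 2
      then have "Domain (f O g) \<notin> F"
        using F_superset[OF _ Dfg] sym_inv_monoid_D(2)[OF f] by blast
      then show ?thesis
        using fg by (simp add: V_iff)
    next
      case 3
      then show ?thesis
        using fg by (simp add: V_iff)
    qed
  next
    case False
    then have pf: "preserves X F f" and df: "|X - Range f| <o \<mu>"
      using fV by (auto simp: V_iff)
    consider "\<mu> \<le>o |X - Domain g|" | "Domain g \<notin> F" | "preserves X F g" "|X - Range g| <o \<mu>"
      using gV False by (auto simp: V_iff)
    then show ?thesis
    proof cases
      case 1
      then have "\<mu> \<le>o |X - Domain (f O g)|"
        using collapse_comp_ge[OF f \<mu>(1) add df] by blast
      then show ?thesis
        using fg by (simp add: V_iff)
    next
      case 2
      have "f `` Domain (f O g) \<subseteq> Domain g"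
        using sym_inv_monoid_D(5)[OF f] by blast
      then have "f `` Domain (f O g) \<notin> F"
        using 2 F_superset sym_inv_monoid_D(2)[OF g] by blast
      then have "Domain (f O g) \<notin> F"
        using pf sym_inv_monoid_D(2)[OF fg] unfolding preserves_def by blast
      then show ?thesis
        using fg by (simp add: V_iff)
    next
      case 3
      have "preserves X F (f O g)"
        by (rule preserves_comp[OF pf 3(1) f])
      moreover have "|X - Range (f O g)| <o \<mu>"
        using defect_comp_less[OF g add df 3(2)] by blast
      ultimately show ?thesis
        using fg by (simp add: V_iff)
    qed
  qed
qed

lemma empty_less_filter_cardinal:
  assumes "\<mu> \<in> filter_cardinals X F"
  shows "|{} :: 'a set| <o \<mu>"
proof -
  obtain C where "C \<in> F" "min_card F = |C|"
    using exists_min_card by blast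
  then show ?thesis
    using card_of_empty[of C] filter_cardinals_D(3)[OF assms] ordLeq_ordLess_trans by fastforce
qed

lemma stabiliser_subset_V:
  assumes "\<mu> \<in> filter_cardinals X F"
  shows "filter_stabiliser X F \<subseteq> V X F \<mu>"
proof
  fix f assume "f \<in> filter_stabiliser X F"
  then show "f \<in> V X F \<mu>"
    using empty_less_filter_cardinal[OF assms] filter_stabiliser_D[of f] by (simp add: V_iff)
qed

text \<open>
  Swap two halves of \<open>X\<close>: exactly one of them belongs to \<open>F\<close>.
\<close>

lemma exists_nonstabilising_permutation: "\<exists>a\<in>Sym X. \<not> preserves X F a"
proof -
  obtain B D where BD: "X = B \<union> D" "B \<inter> D = {}" "|B| =o |X|" "|D| =o |X|"
    using infinite_split[OF infinite_X] by blast
  have "|B| =o |D|"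
    using BD(3,4) ordIso_symmetric ordIso_transitive by blast
  then obtain k where k: "k \<in> I" "Domain k = B" "Range k = D"
    using exists_partial_bijection[of B X D] BD(1) by blast
  have "k \<union> k\<inverse> \<in> I"
    using k BD(2) by (intro sym_inv_monoid_Un) auto
  moreover have "Domain (k \<union> k\<inverse>) = X" "Range (k \<union> k\<inverse>) = X"
    using k BD(1) by auto
  ultimately have "k \<union> k\<inverse> \<in> Sym X"
    by (simp add: Sym_def)
  moreover have im: "(k \<union> k\<inverse>) `` B = D"
    using k BD(2) by blast
  have "B \<in> F \<longleftrightarrow> D \<notin> F"
    using F_compl[of D] BD(1,2) by (metis Diff_cancel Un_Diff Un_empty_right Diff_triv Un_upper2)
  with im have "\<not> preserves X F (k \<union> k\<inverse>)"
    unfolding preserves_def using BD(1) by blast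
  ultimately show ?thesis
    by blast
qed

lemma V_Sym_preserves:
  assumes "\<mu> \<in> filter_cardinals X F" "a \<in> Sym X" "a \<in> V X F \<mu>"
  shows "preserves X F a"
proof -
  have a: "a \<in> I" "Domain a = X" "Range a = X"
    using assms(2) by (auto simp: Sym_def)
  have "\<not> \<mu> \<le>o |X - Domain a|"
    unfolding a(2) Diff_cancel not_ordLeq_card_of[OF filter_cardinals_D(1)[OF assms(1)]]
    by (rule empty_less_filter_cardinal[OF assms(1)])
  moreover have "a \<notin> small_rank X"
    unfolding small_rank_not_small[OF a(1)] a(3) by (rule ordIso_reflexive[OF card_of_Well_order])
  ultimately show ?thesis
    using assms(3) X_in_F unfolding V_iff a(2) by blast
qed

lemma Sym_not_subset_V:
  assumes "\<mu> \<in> filter_cardinals X F"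
  shows "\<not> Sym X \<subseteq> V X F \<mu>"
  using V_Sym_preserves[OF assms] exists_nonstabilising_permutation by blast

lemma Sym_subset: "Sym X \<subseteq> I"
  by (auto simp: Sym_def)

lemma setwise_inverse_iff: "f \<in> setwise_inverse M \<longleftrightarrow> f\<inverse> \<in> M"
  unfolding setwise_inverse_def by (metis converse_converse image_iff)

lemma setwise_inverse_setwise_inverse [simp]: "setwise_inverse (setwise_inverse M) = M"
  by (auto simp: setwise_inverse_iff)

lemma setwise_inverse_mono: "setwise_inverse M \<subseteq> setwise_inverse N \<longleftrightarrow> M \<subseteq> N"
  unfolding subset_iff setwise_inverse_iff by (metis converse_converse)

lemma setwise_inverse_I [simp]: "setwise_inverse I = I"
  by (auto simp: setwise_inverse_iff)

lemma setwise_inverse_stabiliser: "setwise_inverse (filter_stabiliser X F) = filter_stabiliser X F"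
  unfolding set_eq_iff setwise_inverse_iff using filter_stabiliser_converse by (metis converse_converse)

lemma setwise_inverse_Sym: "setwise_inverse (Sym X) = Sym X"
  unfolding set_eq_iff setwise_inverse_iff using Sym_converse by (metis converse_converse)

lemma subsemigroup_setwise_inverse:
  "subsemigroup X M \<Longrightarrow> subsemigroup X (setwise_inverse M)"
  unfolding subsemigroup_def by (auto simp: setwise_inverse_iff converse_relcomp subset_iff)

lemma maximal_subsemigroup_setwise_inverse:
  assumes "maximal_subsemigroup X M"
  shows "maximal_subsemigroup X (setwise_inverse M)"
  unfolding maximal_subsemigroup_def
proof (intro conjI allI impI)
  show "subsemigroup X (setwise_inverse M)"
    using assms subsemigroup_setwise_inverse by (simp add: maximal_subsemigroup_def)
  show "setwise_inverse M \<noteq> I"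
    using assms unfolding maximal_subsemigroup_def
    by (metis setwise_inverse_I setwise_inverse_setwise_inverse)
next
  fix N assume N: "subsemigroup X N \<and> N \<noteq> I \<and> setwise_inverse M \<subseteq> N"
  then have "subsemigroup X (setwise_inverse N)"
    using subsemigroup_setwise_inverse by blast
  moreover have "setwise_inverse N \<noteq> I"
    using N by (metis setwise_inverse_I setwise_inverse_setwise_inverse)
  moreover have "M \<subseteq> setwise_inverse N"
    using N setwise_inverse_mono[of M "setwise_inverse N"] by simp
  ultimately have "setwise_inverse N = M"
    using assms by (auto simp: maximal_subsemigroup_def)
  then show "N = setwise_inverse M"
    by (metis setwise_inverse_setwise_inverse)
qed

text \<open>
  An element outside \<open>V\<close> becomes total after multiplication with a map \<open>s\<close> that both \<open>V\<close> and its
  inverse contain. If \<open>f\<close> does not preserve \<open>F\<close>, the image of \<open>s\<close> is taken to be the set from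
  \<open>not_preserves_witness\<close>, whose image under \<open>f\<close> is outside \<open>F\<close>; if \<open>f\<close> preserves \<open>F\<close>, its
  defect is already at least \<open>\<mu>\<close>, and \<open>s\<close> maps onto the domain of \<open>f\<close>.
\<close>

lemma V_escape:
  assumes \<mu>: "\<mu> \<in> filter_cardinals X F" and f: "f \<in> I" "f \<notin> V X F \<mu>"
  shows "\<exists>s\<in>V X F \<mu> \<inter> setwise_inverse (V X F \<mu>). s O f \<in> I \<and> Domain (s O f) = X \<and>
    (Range (s O f) \<notin> F \<or> \<mu> \<le>o |X - Range (s O f)| )"
proof -
  note card = filter_cardinals_D[OF \<mu>]
  note cf = not_in_V_D(1)[OF \<mu> f] and dom = not_in_V_D(2)[OF \<mu> f]
    and rank = not_in_V_D(3)[OF \<mu> f] and np = not_in_V_D(4)[OF \<mu> f]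
  have domX: "|Domain f| =o |X|"
    using card_of_Range[OF f(1)] rank by (meson ordIso_symmetric ordIso_transitive)
  obtain D where D: "D \<in> F" "D \<subseteq> Domain f" "|D| =o |X|" "|X - D| <o \<mu>"
    "f `` D \<notin> F \<or> \<mu> \<le>o |X - f `` D|"
  proof (cases "preserves X F f")
    case True
    moreover have "f `` Domain f = Range f" by blast
    ultimately show ?thesis
      using that[of "Domain f"] dom domX cf np by simp
  next
    case False
    then obtain D where D: "D \<in> F" "D \<subseteq> Domain f" "f `` D \<notin> F" "|D| =o |X|"
      "|Domain f - D| \<le>o min_card F"
      using not_preserves_witness[OF f(1) dom _ rank] by blast
    have "|Domain f - D| <o \<mu>"
      using D(5) card(3) ordLeq_ordLess_trans by blast
    with cf have "|(X - Domain f) \<union> (Domain f - D)| <o \<mu>"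
      by (rule card_of_Un_ordLess_infinite_Field[OF card(2,1)])
    moreover have "(X - Domain f) \<union> (Domain f - D) = X - D"
      using D(2) sym_inv_monoid_D(2)[OF f(1)] by blast
    ultimately show ?thesis
      using that[OF D(1,2,4)] D(3) by auto
  qed
  obtain s where s: "s \<in> I" "preserves X F s" "Domain s = X" "Range s = D"
    using exists_total_onto[OF D(1,3)] by blast
  have "s \<in> V X F \<mu>"
    using s D(4) by (simp add: V_iff)
  moreover have "s\<inverse> \<in> V X F \<mu>"
    using s preserves_converse[OF s(2,1)] empty_less_filter_cardinal[OF \<mu>] by (simp add: V_iff)
  moreover have "Domain (s O f) = X"
    using s D(2) by blast
  moreover have "Range (s O f) = f `` D"
    using s by blast
  ultimately show ?thesis
    using sym_inv_monoid_comp[OF s(1) f(1)] D(5) by (auto simp: setwise_inverse_iff)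
qed

text \<open>
  The two alternatives for \<open>f\<close>, which are those provided by \<open>V_escape\<close>, are inherited by \<open>Domain g\<close>:
  it is then outside \<open>F\<close> or has a complement of size at least \<open>\<mu>\<close>.
\<close>

lemma V_if_Domain_subset_Range:
  assumes \<mu>: "\<mu> \<in> filter_cardinals X F" and f: "f \<in> I"
    and esc: "Range f \<notin> F \<or> \<mu> \<le>o |X - Range f|"
    and g: "g \<in> I" "Domain g \<subseteq> Range f"
  shows "g \<in> V X F \<mu>"
  using esc
proof
  assume "Range f \<notin> F"
  then have "Domain g \<notin> F"
    using F_superset[OF _ g(2)] sym_inv_monoid_D(3)[OF f] by blast
  then show ?thesis
    using g by (simp add: V_iff)
next
  assume "\<mu> \<le>o |X - Range f|"
  moreover have "|X - Range f| \<le>o |X - Domain g|"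
    using g(2) by (intro card_of_mono1) blast
  ultimately have "\<mu> \<le>o |X - Domain g|"
    by (rule ordLeq_transitive)
  then show ?thesis
    using g by (simp add: V_iff)
qed

lemma total_comp_converse:
  assumes "f \<in> I" "Domain f = X"
  shows "f O f\<inverse> = Id_on X"
proof (intro subset_antisym subrelI)
  fix x z assume "(x, z) \<in> f O f\<inverse>"
  then obtain y where y: "(x, y) \<in> f" "(z, y) \<in> f"
    by blast
  then show "(x, z) \<in> Id_on X"
    using sym_inv_monoid_D(6)[OF assms(1) y] assms(2) by blast
next
  fix x z assume "(x, z) \<in> Id_on X"
  then show "(x, z) \<in> f O f\<inverse>"
    using assms(2) by blast
qed

lemma Id_on_comp: "h \<in> I \<Longrightarrow> Id_on X O h = h" "h \<in> I \<Longrightarrow> h O Id_on X = h"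
  using sym_inv_monoid_D(1)[of h X] by blast+

text \<open>
  A semigroup \<open>N\<close> that properly contains \<open>V\<close> has a total element \<open>k = s O f\<close> as in \<open>V_escape\<close>. For
  each \<open>h\<close> the factor \<open>k\<inverse> O h\<close> lies in \<open>V\<close>, and \<open>h = k O (k\<inverse> O h)\<close>.
\<close>

lemma V_maximal:
  assumes \<mu>: "\<mu> \<in> filter_cardinals X F"
  shows "maximal_subsemigroup X (V X F \<mu>)"
  unfolding maximal_subsemigroup_def
proof (intro conjI allI impI)
  show "subsemigroup X (V X F \<mu>)"
    by (rule V_subsemigroup[OF \<mu>])
  show "V X F \<mu> \<noteq> I"
    using Sym_not_subset_V[OF \<mu>] Sym_subset by blast
next
  fix N assume N: "subsemigroup X N \<and> N \<noteq> I \<and> V X F \<mu> \<subseteq> N"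
  then have NI: "N \<subseteq> I" and comp: "\<And>f g. f \<in> N \<Longrightarrow> g \<in> N \<Longrightarrow> f O g \<in> N"
    by (auto simp: subsemigroup_def)
  show "N = V X F \<mu>"
  proof (rule ccontr)
    assume "N \<noteq> V X F \<mu>"
    then obtain f where f: "f \<in> N" "f \<in> I" "f \<notin> V X F \<mu>"
      using N NI by blast
    obtain s where s: "s \<in> V X F \<mu>" "s O f \<in> I" "Domain (s O f) = X"
      "Range (s O f) \<notin> F \<or> \<mu> \<le>o |X - Range (s O f)|"
      using V_escape[OF \<mu> f(2,3)] by blast
    have sf: "s O f \<in> N"
      using comp s(1) f(1) N by blast
    have "h \<in> N" if h: "h \<in> I" for h
    proof -
      have "(s O f)\<inverse> O h \<in> I"
        using s(2) h by (simp add: sym_inv_monoid_comp del: converse_relcomp)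
      moreover have "Domain ((s O f)\<inverse> O h) \<subseteq> Range (s O f)"
        by blast
      ultimately have "(s O f)\<inverse> O h \<in> N"
        using V_if_Domain_subset_Range[OF \<mu> s(2,4)] N by blast
      with sf have "(s O f) O ((s O f)\<inverse> O h) \<in> N"
        by (rule comp)
      moreover have "(s O f) O ((s O f)\<inverse> O h) = h"
        using total_comp_converse[OF s(2,3)] Id_on_comp(1)[OF h] by (metis O_assoc)
      ultimately show ?thesis
        by simp
    qed
    then show False
      using N NI by blast
  qed
qed

lemma inverse_subsemigroup_Int_setwise_inverse:
  assumes "subsemigroup X M"
  shows "inverse_subsemigroup X (M \<inter> setwise_inverse M)"
  using assms subsemigroup_setwise_inverse[OF assms]
  by (auto simp: inverse_subsemigroup_def subsemigroup_def setwise_inverse_iff)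

text \<open>
  As for \<open>V_maximal\<close>, but the factor has to lie in the inverse of \<open>V\<close> as well. Conjugation achieves
  this: both the domain and the range of \<open>k\<inverse> O h O k\<close> are inside \<open>Range k\<close>, and \<open>k\<inverse>\<close> is
  available because the semigroup is closed under inverses.
\<close>

lemma V_Int_maximal:
  assumes \<mu>: "\<mu> \<in> filter_cardinals X F"
  shows "maximal_inverse_subsemigroup X (V X F \<mu> \<inter> setwise_inverse (V X F \<mu>))"
  unfolding maximal_inverse_subsemigroup_def
proof (intro conjI allI impI)
  let ?W = "V X F \<mu> \<inter> setwise_inverse (V X F \<mu>)"
  show "inverse_subsemigroup X ?W"
    by (rule inverse_subsemigroup_Int_setwise_inverse[OF V_subsemigroup[OF \<mu>]])
  show "?W \<noteq> I"
    using Sym_not_subset_V[OF \<mu>] Sym_subset by blast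
  fix N assume N: "inverse_subsemigroup X N \<and> N \<noteq> I \<and> ?W \<subseteq> N"
  then have NI: "N \<subseteq> I" and comp: "\<And>f g. f \<in> N \<Longrightarrow> g \<in> N \<Longrightarrow> f O g \<in> N"
    and conv: "\<And>f. f \<in> N \<Longrightarrow> f\<inverse> \<in> N"
    by (auto simp: inverse_subsemigroup_def subsemigroup_def)
  show "N = ?W"
  proof (rule ccontr)
    assume "N \<noteq> ?W"
    then obtain f0 where "f0 \<in> N" "f0 \<notin> ?W"
      using N by blast
    then obtain f where f: "f \<in> N" "f \<in> I" "f \<notin> V X F \<mu>"
      using NI conv by (auto simp: setwise_inverse_iff)
    obtain s where s: "s \<in> ?W" "s O f \<in> I" "Domain (s O f) = X"
      "Range (s O f) \<notin> F \<or> \<mu> \<le>o |X - Range (s O f)|"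
      using V_escape[OF \<mu> f(2,3)] by blast
    have sf: "s O f \<in> N"
      using comp s(1) f(1) N by blast
    have "h \<in> N" if h: "h \<in> I" for h
    proof -
      let ?f = "s O f"
      let ?g = "?f\<inverse> O h O ?f"
      have f': "?f\<inverse> \<in> I"
        using s(2) by (simp del: converse_relcomp)
      have g: "?g \<in> I"
        by (intro sym_inv_monoid_comp f' h s(2))
      have "?g\<inverse> \<in> I"
        using g by simp
      moreover have "Domain ?g \<subseteq> Range ?f" "Domain (?g\<inverse>) \<subseteq> Range ?f"
        by blast+
      ultimately have "?g \<in> ?W"
        using V_if_Domain_subset_Range[OF \<mu> s(2,4)] g by (auto simp: setwise_inverse_iff)
      then have "?f O (?g O ?f\<inverse>) \<in> N"
        using comp sf conv N by blast
      moreover have "?f O (?g O ?f\<inverse>) = (?f O ?f\<inverse>) O h O (?f O ?f\<inverse>)"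
        by (simp only: O_assoc)
      then have "?f O (?g O ?f\<inverse>) = h"
        using total_comp_converse[OF s(2,3)] Id_on_comp[OF h] by simp
      ultimately show ?thesis
        by simp
    qed
    then show False
      using N NI by blast
  qed
qed

section \<open>Moving sets by the stabiliser\<close>

text \<open>
  Two disjoint halves of a set cannot both belong to \<open>F\<close>; a finite set never does.
\<close>

lemma exists_subset_notin_F:
  assumes "|K| \<le>o |Z|"
  shows "\<exists>A\<subseteq>Z. |A| =o |K| \<and> A \<notin> F"
proof -
  obtain A where A: "A \<subseteq> Z" "|A| =o |K|"
    using exists_subset_of_card[OF assms] by blast
  show ?thesis
  proof (cases "finite A")
    case True
    then show ?thesis
      using A F_infinite by blast
  next
    case False
    from infinite_split[OF this]
    obtain B C where BC: "A = B \<union> C" "B \<inter> C = {}" "|B| =o |A|" "|C| =o |A|"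
      by blast
    have "|B| =o |K|" "|C| =o |K|"
      by (rule ordIso_transitive[OF BC(3) A(2)], rule ordIso_transitive[OF BC(4) A(2)])
    moreover have "B \<notin> F \<or> C \<notin> F"
      using F_disjoint[OF _ BC(2)] by blast
    ultimately show ?thesis
      using A(1) BC(1) by blast
  qed
qed

lemma exists_subset_in_F:
  assumes "Z \<in> F" "K \<in> F" "|K| \<le>o |Z|"
  shows "\<exists>A\<in>F. A \<subseteq> Z \<and> |A| =o |K|"
proof -
  obtain A where A: "A \<subseteq> Z" "|A| =o |K|"
    using exists_subset_of_card[OF assms(3)] by blast
  obtain C where C: "C \<in> F" "C \<subseteq> Z" "|C| \<le>o min_card F"
    using F_small_subset[OF assms(1)] by blast
  have "|C| \<le>o |K|"
    using C(3) min_card_le[OF assms(2)] by (rule ordLeq_transitive)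
  then have "|A \<union> C| \<le>o |K|"
    using F_infinite[OF assms(2)] ordIso_imp_ordLeq[OF A(2)]
    by (intro card_of_Un_ordLeq_infinite)
  moreover have "|K| \<le>o |A \<union> C|"
    using A(2) card_of_mono1[of A "A \<union> C"] by (meson Un_upper1 ordIso_ordLeq_trans ordIso_symmetric)
  ultimately have "|A \<union> C| =o |K|"
    using ordIso_iff_ordLeq by blast
  moreover have "A \<union> C \<in> F"
    using F_superset[OF C(1)] A(1) C(2) F_subset[OF assms(1)] by blast
  moreover have "A \<union> C \<subseteq> Z"
    using A(1) C(2) by simp
  ultimately show ?thesis
    by blast
qed

text \<open>
  If \<open>D \<in> F\<close>, it is enough to cover \<open>X - D\<close> by the image of a set \<open>A\<close> disjoint from \<open>Y\<close>, where
  \<open>A\<close> has to be outside \<open>F\<close>, as \<open>X - D\<close> is. If \<open>D \<notin> F\<close>, the complement of \<open>D\<close> is in \<open>F\<close>,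
  and so must be the set \<open>A\<close> that is moved onto it; such an \<open>A\<close> disjoint from \<open>Y\<close> exists because
  \<open>Y \<notin> F\<close>. Here \<open>t\<close> is defined on the complement of \<open>A\<close> first, as \<open>extend_to_stabiliser\<close> requires
  domain and range outside \<open>F\<close>.
\<close>

lemma stabiliser_moves_into:
  assumes Y: "Y \<subseteq> X" "|Y| =o |X|" and D: "D \<subseteq> X" "|D| =o |X|"
    and le: "|X - D| \<le>o |X - Y|" and side: "D \<in> F \<or> Y \<notin> F"
  shows "\<exists>t\<in>filter_stabiliser X F. t `` Y \<subseteq> D"
proof -
  have compl: "|X - A| =o |D|" if "A \<subseteq> X - Y" for A
  proof -
    have "|Y| \<le>o |X - A|" "|X - A| \<le>o |X|"
      using that Y(1) by (auto intro!: card_of_mono1)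
    then have "|X - A| =o |X|"
      using Y(2) by (meson ordIso_iff_ordLeq ordIso_ordLeq_trans ordIso_symmetric)
    then show ?thesis
      using D(2) ordIso_symmetric ordIso_transitive by blast
  qed
  show ?thesis
  proof (cases "D \<in> F")
    case True
    obtain A where A: "A \<subseteq> X - Y" "|A| =o |X - D|" "A \<notin> F"
      using exists_subset_notin_F[OF le] by blast
    then obtain h where h: "h \<in> I" "Domain h = A" "Range h = X - D"
      using exists_partial_bijection[of A X "X - D"] by blast
    have "X - (X - D) = D"
      using D(1) by blast
    then have "|X - Domain h| =o |X - Range h|"
      using compl[OF A(1)] h by simp
    moreover have "Domain h \<notin> F" "Range h \<notin> F"
      using h A(3) True F_compl[OF D(1)] by auto
    ultimately obtain t where t: "t \<in> filter_stabiliser X F" "h \<subseteq> t"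
      using extend_to_stabiliser[OF h(1)] by blast
    note tI = filter_stabiliser_D(1)[OF t(1)]
    have "t `` Y \<subseteq> D"
    proof
      fix z assume "z \<in> t `` Y"
      then obtain y where y: "y \<in> Y" "(y, z) \<in> t"
        by blast
      show "z \<in> D"
      proof (rule ccontr)
        assume "z \<notin> D"
        then have "z \<in> Range h"
          using h(3) y(2) sym_inv_monoid_D(1)[OF tI] by blast
        then obtain a where a: "(a, z) \<in> h"
          by blast
        then have "a = y"
          using sym_inv_monoid_D(6)[OF tI _ y(2)] t(2) by blast
        then show False
          using a h(2) A(1) y(1) by blast
      qed
    qed
    then show ?thesis
      using t(1) by blast
  next
    case False
    then have "X - D \<in> F" "X - Y \<in> F"
      using side Y(1) D(1) by (simp_all add: F_compl)
    then obtain A where A: "A \<in> F" "A \<subseteq> X - Y" "|A| =o |X - D|"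
      using exists_subset_in_F[OF _ _ le] by blast
    obtain h where h: "h \<in> I" "Domain h = X - A" "Range h = D"
      using exists_partial_bijection[OF _ D(1) compl[OF A(2)]] by blast
    have "X - (X - A) = A"
      using A(2) by blast
    then have "|X - Domain h| =o |X - Range h|"
      using A(3) h by simp
    moreover have "Domain h \<notin> F" "Range h \<notin> F"
      using h False A(1) F_compl[OF F_subset[OF A(1)]] by auto
    ultimately obtain t where t: "t \<in> filter_stabiliser X F" "h \<subseteq> t"
      using extend_to_stabiliser[OF h(1)] by blast
    have "t `` Y \<subseteq> D"
    proof
      fix z assume "z \<in> t `` Y"
      then obtain y where y: "y \<in> Y" "(y, z) \<in> t"
        by blast
      then obtain w where w: "(y, w) \<in> h"
        using h(2) A(2) Y(1) by blast
      then have "w = z"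
        using sym_inv_monoid_D(5)[OF filter_stabiliser_D(1)[OF t(1)] _ y(2)] t(2) by blast
      then show "z \<in> D"
        using w h(3) by blast
    qed
    then show ?thesis
      using t(1) by blast
  qed
qed

section \<open>Semigroups containing the symmetric group\<close>

text \<open>
  The cardinal that separates collapse from defect is given by a set \<open>A\<close>, so that singletons and
  infinite subsets of \<open>X\<close> cover the value \<open>1\<close> and all infinite values up to \<open>|X|\<close> uniformly.
\<close>

definition collapse_defect_semigroup :: "'a set \<Rightarrow> 'a rel set"
  where "collapse_defect_semigroup A =
    {f \<in> I. |A| \<le>o |X - Domain f| \<or> |X - Range f| <o |A| }"

lemma collapse_defect_semigroup_subsemigroup:
  assumes "infinite A \<or> (\<exists>x. A = {x})"
  shows "subsemigroup X (collapse_defect_semigroup A)"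
  unfolding subsemigroup_def
proof (intro conjI ballI)
  show "collapse_defect_semigroup A \<subseteq> I"
    by (auto simp: collapse_defect_semigroup_def)
next
  have add: "|B \<union> C| <o |A|" if "|B| <o |A|" "|C| <o |A|" for B C :: "'a set"
    using assms
  proof
    assume "infinite A"
    then show ?thesis
      using that by (rule card_of_Un_ordLess_infinite)
  next
    assume "\<exists>x. A = {x}"
    then obtain x where x: "A = {x}"
      by blast
    have "B = {}"
    proof (rule ccontr)
      assume "B \<noteq> {}"
      then have "|A| \<le>o |B|"
        unfolding x by (rule card_of_singl_ordLeq)
      then show False
        using that(1) not_ordLess_ordLeq by blast
    qed
    then show ?thesis
      using that(2) by simp
  qed
  note \<mu> = card_of_Card_order[of A]
  fix f g assume "f \<in> collapse_defect_semigroup A" "g \<in> collapse_defect_semigroup A"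
  then have f: "f \<in> I" "|A| \<le>o |X - Domain f| \<or> |X - Range f| <o |A|"
    and g: "g \<in> I" "|A| \<le>o |X - Domain g| \<or> |X - Range g| <o |A|"
    by (auto simp: collapse_defect_semigroup_def)
  have fg: "f O g \<in> I"
    by (rule sym_inv_monoid_comp[OF f(1) g(1)])
  have "|A| \<le>o |X - Domain (f O g)| \<or> |X - Range (f O g)| <o |A|"
    using f(2)
  proof
    assume "|A| \<le>o |X - Domain f|"
    then show ?thesis
      using collapse_comp_le ordLeq_transitive by blast
  next
    assume df: "|X - Range f| <o |A|"
    from g(2) show ?thesis
    proof
      assume "|A| \<le>o |X - Domain g|"
      with collapse_comp_ge[OF f(1) \<mu> add df] show ?thesis
        by blast
    next
      assume "|X - Range g| <o |A|"
      with defect_comp_less[OF g(1) add df] show ?thesis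
        by blast
    qed
  qed
  then show "f O g \<in> collapse_defect_semigroup A"
    using fg by (simp add: collapse_defect_semigroup_def)
qed

lemma card_of_empty_ordLess:
  assumes "A \<noteq> {}"
  shows "|{}| <o |A|"
proof -
  have "\<not> |A| \<le>o |{}|"
    using assms card_of_empty3 by blast
  then show ?thesis
    by (simp add: not_ordLeq_iff_ordLess card_of_Well_order)
qed

lemma Sym_subset_collapse_defect_semigroup:
  assumes "A \<noteq> {}"
  shows "Sym X \<subseteq> collapse_defect_semigroup A"
proof
  fix f assume "f \<in> Sym X"
  then have "f \<in> I" "Range f = X"
    by (auto simp: Sym_def)
  then show "f \<in> collapse_defect_semigroup A"
    by (simp add: collapse_defect_semigroup_def card_of_empty_ordLess[OF assms])
qed

lemma collapse_defect_semigroup_proper: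
  assumes "A \<noteq> {}" "A \<subseteq> X"
  shows "collapse_defect_semigroup A \<noteq> I"
proof -
  obtain B D where BD: "X = B \<union> D" "B \<inter> D = {}" "|B| =o |X|" "|D| =o |X|"
    using infinite_split[OF infinite_X] by blast
  obtain k where k: "k \<in> I" "Domain k = X" "Range k = B"
    using exists_partial_bijection[of X X B] BD(1) ordIso_symmetric[OF BD(3)] by blast
  have "X - Range k = D"
    using k BD(1,2) by blast
  moreover have "|A| \<le>o |D|"
    using card_of_mono1[OF assms(2)] ordIso_symmetric[OF BD(4)] ordLeq_ordIso_trans by blast
  moreover have "\<not> |A| \<le>o |X - Domain k|"
    using k(2) card_of_empty3[of A] assms(1) by auto
  ultimately have "k \<notin> collapse_defect_semigroup A"
    using not_ordLess_ordLeq by (auto simp: collapse_defect_semigroup_def)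
  then show ?thesis
    using k(1) by blast
qed

end

section \<open>Recovering the symmetric group\<close>

text \<open>
  What survives in a maximal subsemigroup that contains the stabiliser but not \<open>Sym X\<close> and that is
  not contained in any \<open>V\<close>. Both kinds of maximality lead to this situation, and the results below
  apply to \<open>M\<close> and to its inverse alike.
\<close>

locale rich_semigroup = free_ultrafilter +
  fixes M :: "'a rel set"
  assumes M_subsemigroup: "subsemigroup X M"
    and stabiliser_subset: "filter_stabiliser X F \<subseteq> M"
    and not_subset_V: "\<mu> \<in> filter_cardinals X F \<Longrightarrow> \<not> M \<subseteq> V X F \<mu>"
    and not_subset_collapse_defect_semigroup:
      "A \<subseteq> X \<Longrightarrow> infinite A \<or> (\<exists>x. A = {x}) \<Longrightarrow> \<not> M \<subseteq> collapse_defect_semigroup A"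
begin

lemma M_subset: "f \<in> M \<Longrightarrow> f \<in> I"
  and M_comp: "f \<in> M \<Longrightarrow> g \<in> M \<Longrightarrow> f O g \<in> M"
  using M_subsemigroup by (auto simp: subsemigroup_def)

lemma exists_not_in_V:
  assumes "\<mu> \<in> filter_cardinals X F"
  shows "\<exists>f\<in>M. |X - Domain f| <o \<mu> \<and> Domain f \<in> F \<and> |Range f| =o |X| \<and>
    (\<not> preserves X F f \<or> \<mu> \<le>o |X - Range f| )"
proof -
  obtain f where f: "f \<in> M" "f \<notin> V X F \<mu>"
    using not_subset_V[OF assms] by blast
  note not_in_V_D[OF assms M_subset[OF f(1)] f(2)]
  with f(1) show ?thesis
    by blast
qed

text \<open>
  The composite is \<open>p O t O f\<close> with \<open>t\<close> in the stabiliser and \<open>t `` Range p \<subseteq> D\<close>.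
\<close>

lemma total_comp_into:
  assumes p: "p \<in> M" "Domain p = X" and f: "f \<in> M" and D: "D \<subseteq> Domain f" "|D| =o |X|"
    and le: "|X - D| \<le>o |X - Range p|" and side: "D \<in> F \<or> Range p \<notin> F"
  shows "\<exists>q\<in>M. Domain q = X \<and> Range q \<subseteq> f `` D"
proof -
  note pI = M_subset[OF p(1)]
  have "|Range p| =o |X|"
    using card_of_Range[OF pI] p(2) by simp
  moreover have "D \<subseteq> X"
    using D(1) sym_inv_monoid_D(2)[OF M_subset[OF f]] by blast
  ultimately obtain t where t: "t \<in> filter_stabiliser X F" "t `` Range p \<subseteq> D"
    using stabiliser_moves_into[OF sym_inv_monoid_D(3)[OF pI] _ _ D(2) le side] by blast
  have tM: "t \<in> M"
    using t(1) stabiliser_subset by blast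
  have "p O (t O f) \<in> M"
    by (intro M_comp p(1) tM f)
  moreover have "Range (p O (t O f)) \<subseteq> f `` D"
    using t(2) by blast
  moreover have "Domain (p O (t O f)) = X"
  proof (intro subset_antisym subsetI)
    fix x assume "x \<in> Domain (p O (t O f))"
    then show "x \<in> X"
      using p(2) by blast
  next
    fix x assume "x \<in> X"
    then obtain y where y: "(x, y) \<in> p"
      using p(2) by blast
    then have "y \<in> Domain t"
      using filter_stabiliser_D(2)[OF t(1)] sym_inv_monoid_D(1)[OF pI] by blast
    then obtain z where z: "(y, z) \<in> t"
      by blast
    then have "z \<in> Domain f"
      using t(2) y D(1) by blast
    then show "x \<in> Domain (p O (t O f))"
      using y z by blast
  qed
  ultimately show ?thesis
    by blast
qed

text \<open>
  Moving \<open>Range p\<close> into the set \<open>D\<close> of \<open>not_preserves_witness\<close> gives a total map \<open>q\<close> with range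
  outside \<open>F\<close>. The bounds on \<open>c f\<close> and \<open>min(F)\<close> say that \<open>p\<close> leaves enough room for this. Since
  \<open>q\<close> alone may have small defect, the map used is \<open>p O q\<close>, whose defect is at least that of \<open>p\<close>.
\<close>

lemma exists_total_Range_notin_F:
  assumes p: "p \<in> M" "Domain p = X" and f: "f \<in> M" "Domain f \<in> F" "|Range f| =o |X|"
    and np: "\<not> preserves X F f"
    and cf: "|X - Domain f| \<le>o |X - Range p|" and min: "min_card F \<le>o |X - Range p|"
  shows "\<exists>q\<in>M. Domain q = X \<and> Range q \<notin> F \<and> |X - Range p| \<le>o |X - Range q|"
proof -
  note fI = M_subset[OF f(1)]
  obtain D where D: "D \<in> F" "D \<subseteq> Domain f" "f `` D \<notin> F" "|D| =o |X|"
    "|Domain f - D| \<le>o min_card F"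
    using not_preserves_witness[OF fI f(2) np f(3)] by blast
  obtain C where C: "C \<in> F" "min_card F = |C|"
    using exists_min_card by blast
  have inf: "infinite (X - Range p)"
    using min card_of_ordLeq_finite F_infinite[OF C(1)] unfolding C(2) by blast
  have "|Domain f - D| \<le>o |X - Range p|"
    using D(5) min by (rule ordLeq_transitive)
  with cf have "|(X - Domain f) \<union> (Domain f - D)| \<le>o |X - Range p|"
    by (rule card_of_Un_ordLeq_infinite[OF inf])
  moreover have "(X - Domain f) \<union> (Domain f - D) = X - D"
    using D(2) sym_inv_monoid_D(2)[OF fI] by blast
  ultimately obtain q where q: "q \<in> M" "Domain q = X" "Range q \<subseteq> f `` D"
    using total_comp_into[OF p f(1) D(2,4)] D(1) by auto
  have "Range (p O q) \<subseteq> f `` D"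
    using q(3) by blast
  then have "Range (p O q) \<notin> F"
    using D(3) F_superset sym_inv_monoid_D(4)[OF fI] by blast
  moreover have "Domain (p O q) = X"
    using p(2) q(2) sym_inv_monoid_D(3)[OF M_subset[OF p(1)]] by blast
  moreover have "|X - Range p| \<le>o |X - Range (p O q)|"
    by (rule defect_comp_ge[OF M_subset[OF p(1)] M_subset[OF q(1)] q(2)])
  ultimately show ?thesis
    using M_comp[OF p(1) q(1)] by blast
qed

lemma Id_on_in_M: "Id_on X \<in> M"
proof -
  have "preserves X F (Id_on X)"
    by (rule preserves_if_Id_on[OF sym_inv_monoid_Id_on X_in_F]) auto
  then show ?thesis
    using stabiliser_subset Id_on_Sym by (auto simp: filter_stabiliser_def)
qed

text \<open>
  The semigroup for \<open>A = {x}\<close> provides a total map in \<open>M\<close> that is not surjective; each factor of this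
  kind increases the defect by at least one.
\<close>

lemma exists_total_defect_ge_finite:
  assumes "finite A" "A \<subseteq> X"
  shows "\<exists>p\<in>M. Domain p = X \<and> |A| \<le>o |X - Range p|"
  using assms
proof (induction A rule: finite_induct)
  case empty
  show ?case
    using Id_on_in_M by (intro bexI[of _ "Id_on X"]) (auto intro: card_of_empty)
next
  case (insert x A)
  then obtain p where p: "p \<in> M" "Domain p = X" "|A| \<le>o |X - Range p|"
    by blast
  obtain f where f: "f \<in> M" "\<not> |{x}| \<le>o |X - Domain f|" "\<not> |X - Range f| <o |{x}|"
    using not_subset_collapse_defect_semigroup[of "{x}"] insert.prems M_subset
    by (auto simp: collapse_defect_semigroup_def)
  note fI = M_subset[OF f(1)]
  have domf: "Domain f = X"
    using f(2) card_of_singl_ordLeq[of "X - Domain f" x] sym_inv_monoid_D(2)[OF fI] by blast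
  have "X - Range f \<noteq> {}"
    using f(3) card_of_empty_ordLess[of "{x}"] by (metis insert_not_empty)
  then obtain y where y: "y \<in> X" "y \<notin> Range f"
    by blast
  obtain h where h: "inj_on h A" "h ` A \<subseteq> X - Range p"
    using p(3) card_of_ordLeq by metis
  have sub: "insert y (f `` (h ` A)) \<subseteq> X - Range (p O f)"
  proof
    fix z assume "z \<in> insert y (f `` (h ` A))"
    then consider "z = y" | a where "a \<in> A" "(h a, z) \<in> f"
      by blast
    then show "z \<in> X - Range (p O f)"
    proof cases
      case 1
      then show ?thesis using y by blast
    next
      case 2
      have "h a \<notin> Range p"
        using h(2) 2(1) by blast
      then show ?thesis
        using sym_inv_monoid_D(6)[OF fI 2(2)] sym_inv_monoid_D(1)[OF fI] 2(2) by blast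
    qed
  qed
  have "|A| =o |h ` A|"
    using h(1) by (meson card_of_ordIsoI inj_on_imp_bij_betw)
  also have "|h ` A| =o |f `` (h ` A)|"
    by (rule ordIso_symmetric, rule card_of_Image_Domain[OF fI]) (use h(2) domf in blast)
  finally have iso: "|A| =o |f `` (h ` A)|" .
  then obtain g where g: "bij_betw g A (f `` (h ` A))"
    using card_of_ordIso by blast
  have "bij_betw (g(x := y)) A (f `` (h ` A))"
    using g insert.hyps(2) by (subst bij_betw_cong[of A _ g]) auto
  moreover have "bij_betw (g(x := y)) {x} {y}"
    by simp
  ultimately have "bij_betw (g(x := y)) (A \<union> {x}) (f `` (h ` A) \<union> {y})"
    by (rule bij_betw_combine) (use y(2) in blast)
  then have "bij_betw (g(x := y)) (insert x A) (insert y (f `` (h ` A)))"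
    by simp
  then have "|insert x A| =o |insert y (f `` (h ` A))|"
    by (rule card_of_ordIsoI)
  then have "|insert x A| \<le>o |X - Range (p O f)|"
    using card_of_mono1[OF sub] ordIso_ordLeq_trans by blast
  moreover have "Domain (p O f) = X"
    using p(2) domf sym_inv_monoid_D(3)[OF M_subset[OF p(1)]] by blast
  ultimately show ?case
    using M_comp[OF p(1) f(1)] by blast
qed

text \<open>
  Cardinals in \<open>filter_cardinals\<close> are relations on sets of points; taking singletons represents the
  cardinality of \<open>A\<close> at that type.
\<close>

lemma card_singletons_in_filter_cardinals:
  assumes "A \<subseteq> X" "min_card F <o |A|"
  shows "|(\<lambda>x. {x}) ` A| \<in> filter_cardinals X F" "|(\<lambda>x. {x}) ` A| =o |A|"
proof -
  have "inj_on (\<lambda>x. {x}) A"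
    by auto
  then show iso: "|(\<lambda>x. {x}) ` A| =o |A|"
    by (meson card_of_ordIsoI inj_on_imp_bij_betw ordIso_symmetric)
  have "|(\<lambda>x. {x}) ` A| \<le>o |X|"
    using iso card_of_mono1[OF assms(1)] ordIso_ordLeq_trans by blast
  then have "|(\<lambda>x. {x}) ` A| \<le>o cardSuc |X|"
    using cardSuc_ordLeq[OF card_of_Card_order] ordLeq_transitive by blast
  then show "|(\<lambda>x. {x}) ` A| \<in> filter_cardinals X F"
    using assms(2) iso ordIso_symmetric ordLess_ordIso_trans card_of_Card_order
    unfolding filter_cardinals_def by blast
qed

text \<open>
  Take \<open>f \<in> M\<close> with \<open>c f < |A| \<le> d f\<close>. A total \<open>p \<in> M\<close> with \<open>d p \<ge> c f\<close>, moved into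
  \<open>Domain f\<close>, gives \<open>p O t O f\<close> of defect at least \<open>d f\<close>. The induction hypothesis supplies \<open>p\<close>, and
  this settles the case \<open>Domain f \<in> F\<close>. Otherwise \<open>X - Domain f\<close> is in \<open>F\<close>, hence
  \<open>min(F) \<le> c f < |A|\<close>, and \<open>M\<close> contains some \<open>g\<close> outside \<open>V\<close> for \<open>\<mu> = |A|\<close>. If \<open>d g \<ge> |A|\<close>,
  then \<open>g\<close> takes the place of \<open>f\<close>, because its domain is in \<open>F\<close>. If not, \<open>g\<close> does not preserve
  \<open>F\<close> and is used to replace \<open>p\<close> by a total map with range outside \<open>F\<close>, which can be moved into
  \<open>Domain f\<close>.
\<close>

lemma exists_total_defect_ge_step:
  assumes A: "A \<subseteq> X" "infinite A"
    and IH: "\<And>B. B \<subseteq> X \<Longrightarrow> |B| <o |A| \<Longrightarrow> \<exists>p\<in>M. Domain p = X \<and> |B| \<le>o |X - Range p|"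
  shows "\<exists>p\<in>M. Domain p = X \<and> |A| \<le>o |X - Range p|"
proof -
  \<comment> \<open>A collapse below \<open>|A|\<close> leaves a domain of full cardinality, as \<open>total_comp_into\<close> needs.\<close>
  have card_Domain: "|Domain f| =o |X|" if "f \<in> M" "|X - Domain f| <o |A|" for f
  proof -
    have "|X - Domain f| <o |X|"
      using that(2) card_of_mono1[OF A(1)] ordLess_ordLeq_trans by blast
    then have "|X - (X - Domain f)| =o |X|"
      by (rule card_of_Diff_infinite[OF infinite_X])
    moreover have "X - (X - Domain f) = Domain f"
      using sym_inv_monoid_D(2)[OF M_subset[OF that(1)]] by blast
    ultimately show ?thesis
      by simp
  qed
  have finish: ?thesis
    if p: "p \<in> M" "Domain p = X" and f: "f \<in> M" "|X - Domain f| <o |A|" "|A| \<le>o |X - Range f|"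
      and le: "|X - Domain f| \<le>o |X - Range p|" and side: "Domain f \<in> F \<or> Range p \<notin> F" for p f
  proof -
    obtain q where q: "q \<in> M" "Domain q = X" "Range q \<subseteq> f `` Domain f"
      using total_comp_into[OF p f(1) subset_refl card_Domain[OF f(1,2)] le side] by blast
    have "|X - Range f| \<le>o |X - Range q|"
      using q(3) by (intro card_of_mono1) blast
    then show ?thesis
      using q(1,2) f(3) ordLeq_transitive by blast
  qed
  obtain f where f: "f \<in> M" "\<not> |A| \<le>o |X - Domain f|" "\<not> |X - Range f| <o |A|"
    using not_subset_collapse_defect_semigroup[OF A(1)] A(2) M_subset
    by (auto simp: collapse_defect_semigroup_def)
  then have cf: "|X - Domain f| <o |A|" and df: "|A| \<le>o |X - Range f|"
    using not_ordLeq_card_of not_ordLess_card_of card_of_Card_order by blast+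
  show ?thesis
  proof (cases "Domain f \<in> F")
    case True
    obtain p where "p \<in> M" "Domain p = X" "|X - Domain f| \<le>o |X - Range p|"
      using IH[OF _ cf] by blast
    then show ?thesis
      using finish f(1) cf df True by blast
  next
    case False
    then have "X - Domain f \<in> F"
      using F_compl sym_inv_monoid_D(2)[OF M_subset[OF f(1)]] by blast
    then have min_cf: "min_card F \<le>o |X - Domain f|"
      by (rule min_card_le)
    then have "min_card F <o |A|"
      using cf ordLeq_ordLess_trans by blast
    note \<mu> = card_singletons_in_filter_cardinals[OF A(1) this]
    obtain g where g: "g \<in> M" "|X - Domain g| <o |A|" "Domain g \<in> F" "|Range g| =o |X|"
      "\<not> preserves X F g \<or> |A| \<le>o |X - Range g|"
      using exists_not_in_V[OF \<mu>(1)] \<mu>(2) ordLess_ordIso_trans ordIso_ordLeq_trans ordIso_symmetric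
      by metis
    \<comment> \<open>One \<open>p\<close> with room for the complements of both domains serves the two cases below.\<close>
    let ?B = "(X - Domain f) \<union> (X - Domain g)"
    have "|?B| <o |A|"
      by (rule card_of_Un_ordLess_infinite[OF A(2) cf g(2)])
    then obtain p where p: "p \<in> M" "Domain p = X" "|?B| \<le>o |X - Range p|"
      using IH[of ?B] by blast
    have le_f: "|X - Domain f| \<le>o |X - Range p|" and le_g: "|X - Domain g| \<le>o |X - Range p|"
      using p(3) ordLeq_transitive[OF card_of_mono1] by (meson Un_upper1 Un_upper2)+
    show ?thesis
    proof (cases "|A| \<le>o |X - Range g|")
      case True
      then show ?thesis
        using finish[OF p(1,2) g(1,2)] le_g g(3) by blast
    next
      case np: False
      have "min_card F \<le>o |X - Range p|"
        using min_cf le_f by (rule ordLeq_transitive)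
      then obtain q where q: "q \<in> M" "Domain q = X" "Range q \<notin> F" "|X - Range p| \<le>o |X - Range q|"
        using exists_total_Range_notin_F[OF p(1,2) g(1,3,4) _ le_g] np g(5) by blast
      have "|X - Domain f| \<le>o |X - Range q|"
        using le_f q(4) by (rule ordLeq_transitive)
      then show ?thesis
        using finish[OF q(1,2) f(1) cf df] q(3) by blast
    qed
  qed
qed

lemma exists_total_defect_ge:
  assumes "A \<subseteq> X"
  shows "\<exists>p\<in>M. Domain p = X \<and> |A| \<le>o |X - Range p|"
proof (rule ccontr)
  let ?bad = "\<lambda>A. A \<subseteq> X \<and> \<not> (\<exists>p\<in>M. Domain p = X \<and> |A| \<le>o |X - Range p| )"
  assume "\<not> ?thesis"
  with assms have ne: "card_of ` Collect ?bad \<noteq> {}"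
    by blast
  have "\<forall>r\<in>card_of ` Collect ?bad. Well_order r"
    using card_of_Well_order by blast
  from exists_minim_Well_order[OF ne this]
  obtain B where B: "?bad B" "\<And>C. ?bad C \<Longrightarrow> |B| \<le>o |C|"
    by (auto simp del: not_ex)
  from B(1) have "infinite B"
    using exists_total_defect_ge_finite by blast
  moreover have "\<exists>p\<in>M. Domain p = X \<and> |C| \<le>o |X - Range p|" if "C \<subseteq> X" "|C| <o |B|" for C
    using B(2)[of C] that not_ordLess_ordLeq by blast
  ultimately show False
    using exists_total_defect_ge_step[of B] B(1) by blast
qed

text \<open>
  For \<open>\<mu> = |X|\<^sup>+\<close> no defect reaches \<open>\<mu>\<close>, so the element of \<open>M\<close> outside \<open>V\<close> fails to preserve
  \<open>F\<close>. A map of full defect has enough room to be combined with it.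
\<close>

lemma exists_total_full_defect:
  "\<exists>p\<in>M. Domain p = X \<and> Range p \<notin> F \<and> |X - Range p| =o |X|"
proof -
  obtain p where p: "p \<in> M" "Domain p = X" "|X| \<le>o |X - Range p|"
    using exists_total_defect_ge[OF subset_refl] by blast
  obtain f where f: "f \<in> M" "Domain f \<in> F" "|Range f| =o |X|"
    "\<not> preserves X F f \<or> cardSuc |X| \<le>o |X - Range f|"
    using exists_not_in_V[OF cardSuc_in_filter_cardinals] by blast
  have sub: "|X - B| \<le>o |X|" for B
    by (rule card_of_mono1) blast
  have "|X - Range f| <o cardSuc |X|"
    using sub cardSuc_greater[OF card_of_Card_order] ordLeq_ordLess_trans by blast
  then have "\<not> preserves X F f"
    using f(4) not_ordLess_ordLeq by blast
  moreover have "|X - Domain f| \<le>o |X - Range p|"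
    using sub p(3) by (rule ordLeq_transitive)
  moreover have "min_card F \<le>o |X - Range p|"
    using min_card_le[OF X_in_F] p(3) by (rule ordLeq_transitive)
  ultimately obtain q where q: "q \<in> M" "Domain q = X" "Range q \<notin> F" "|X - Range p| \<le>o |X - Range q|"
    using exists_total_Range_notin_F[OF p(1,2) f(1-3)] by blast
  have "|X| \<le>o |X - Range q|"
    using p(3) q(4) by (rule ordLeq_transitive)
  then have "|X - Range q| =o |X|"
    using sub ordIso_iff_ordLeq by blast
  then show ?thesis
    using q by blast
qed

end

context free_ultrafilter
begin

text \<open>
  The inverse of \<open>M\<close> contributes a surjective \<open>q'\<inverse> \<in> M\<close>. For a permutation \<open>b\<close> the map
  \<open>h = p\<inverse> O b O q'\<close> is a bijection from \<open>Range p\<close> to \<open>Range q'\<close>. Both of these are outside \<open>F\<close>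
  and have complements of size \<open>|X|\<close>, so \<open>h\<close> extends to some \<open>t\<close> in the stabiliser, and
  \<open>p O t O q'\<inverse> = b\<close>.
\<close>

lemma rich_semigroup_pair_contains_Sym:
  assumes "rich_semigroup X F M" and "rich_semigroup X F (setwise_inverse M)"
  shows "Sym X \<subseteq> M"
proof
  fix b assume b: "b \<in> Sym X"
  interpret M: rich_semigroup X F M
    by (rule assms(1))
  interpret M': rich_semigroup X F "setwise_inverse M"
    by (rule assms(2))
  obtain p where p: "p \<in> M" "Domain p = X" "Range p \<notin> F" "|X - Range p| =o |X|"
    using M.exists_total_full_defect by blast
  obtain q' where q': "q' \<in> setwise_inverse M" "Domain q' = X" "Range q' \<notin> F" "|X - Range q'| =o |X|"
    using M'.exists_total_full_defect by blast
  have q: "q'\<inverse> \<in> M"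
    using q'(1) by (simp add: setwise_inverse_iff)
  note pI = M.M_subset[OF p(1)] and qI = M'.M_subset[OF q'(1)]
  have bI: "b \<in> I" "Domain b = X" "Range b = X"
    using b by (auto simp: Sym_def)
  define h where "h = p\<inverse> O (b O q')"
  have h: "h \<in> I"
    unfolding h_def by (intro sym_inv_monoid_comp bI qI) (use pI in simp)
  have hD: "Domain h = Range p"
  proof (intro subset_antisym subsetI)
    fix y assume "y \<in> Range p"
    then obtain x where x: "(x, y) \<in> p"
      by blast
    then obtain z where z: "(x, z) \<in> b"
      using bI(2) sym_inv_monoid_D(1)[OF pI] by blast
    then obtain w where "(z, w) \<in> q'"
      using q'(2) bI(3) by blast
    with x z show "y \<in> Domain h"
      unfolding h_def by blast
  qed (auto simp: h_def)
  have hR: "Range h = Range q'"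
  proof (intro subset_antisym subsetI)
    fix w assume "w \<in> Range q'"
    then obtain z where z: "(z, w) \<in> q'"
      by blast
    then obtain x where x: "(x, z) \<in> b"
      using bI(3) sym_inv_monoid_D(1)[OF qI] by blast
    then obtain y where "(x, y) \<in> p"
      using p(2) bI(2) by blast
    with x z show "w \<in> Range h"
      unfolding h_def by blast
  qed (auto simp: h_def)
  have "|X - Domain h| =o |X - Range h|"
    unfolding hD hR by (rule ordIso_transitive[OF p(4) ordIso_symmetric[OF q'(4)]])
  then obtain t where t: "t \<in> filter_stabiliser X F" "h \<subseteq> t"
    using extend_to_stabiliser[OF h] p(3) q'(3) unfolding hD hR by blast
  note tI = filter_stabiliser_D(1)[OF t(1)]
  let ?b = "p O (t O q'\<inverse>)"
  have "?b \<in> M"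
    using M.M_comp[OF p(1) M.M_comp[OF _ q]] t(1) M.stabiliser_subset by blast
  moreover have "?b = b"
  proof
    have "b \<subseteq> p O (h O q'\<inverse>)"
    proof
      fix e assume "e \<in> b"
      then obtain x z where e: "e = (x, z)" "(x, z) \<in> b"
        by (cases e) auto
      then obtain y where y: "(x, y) \<in> p"
        using p(2) bI(2) by blast
      obtain w where w: "(z, w) \<in> q'"
        using q'(2) bI(3) e(2) by blast
      have "(y, w) \<in> h"
        unfolding h_def using y w e(2) by blast
      then show "e \<in> p O (h O q'\<inverse>)"
        unfolding e(1) using y w by blast
    qed
    then show sub: "b \<subseteq> ?b"
      using t(2) by blast
    have "?b \<in> I"
      by (rule M.M_subset) fact
    show "?b \<subseteq> b"
    proof (rule subrelI)
      fix x z assume xz: "(x, z) \<in> ?b"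
      then obtain z' where z': "(x, z') \<in> b"
        using bI(2) p(2) by blast
      then have "z = z'"
        using sym_inv_monoid_D(5)[OF \<open>?b \<in> I\<close> xz] sub by blast
      then show "(x, z) \<in> b"
        using z' by simp
    qed
  qed
  ultimately show "b \<in> M"
    by simp
qed

section \<open>The classification\<close>

text \<open>
  A maximal subsemigroup inside some \<open>collapse_defect_semigroup\<close>, which is proper, would be equal to
  it and so contain \<open>Sym X\<close>.
\<close>

lemma maximal_subsemigroup_rich:
  assumes M: "maximal_subsemigroup X M" "filter_stabiliser X F \<subseteq> M" "\<not> Sym X \<subseteq> M"
    and V: "\<And>\<mu>. \<mu> \<in> filter_cardinals X F \<Longrightarrow> \<not> M \<subseteq> V X F \<mu>"
  shows "rich_semigroup X F M"
proof unfold_locales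
  show "subsemigroup X M"
    using M(1) by (simp add: maximal_subsemigroup_def)
  fix A assume A: "A \<subseteq> X" "infinite A \<or> (\<exists>x. A = {x})"
  then have ne: "A \<noteq> {}"
    by auto
  show "\<not> M \<subseteq> collapse_defect_semigroup A"
  proof
    assume "M \<subseteq> collapse_defect_semigroup A"
    then have "collapse_defect_semigroup A = M"
      using M(1) collapse_defect_semigroup_subsemigroup[OF A(2)] collapse_defect_semigroup_proper[OF ne A(1)]
      unfolding maximal_subsemigroup_def by blast
    then show False
      using M(3) Sym_subset_collapse_defect_semigroup[OF ne] by simp
  qed
qed (use M(2) V in auto)

lemma maximal_subsemigroup_cases:
  assumes M: "maximal_subsemigroup X M" "filter_stabiliser X F \<subseteq> M" "\<not> Sym X \<subseteq> M"
  shows "\<exists>\<mu>\<in>filter_cardinals X F. M = V X F \<mu> \<or> M = setwise_inverse (V X F \<mu>)"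
proof (rule ccontr)
  assume none: "\<not> ?thesis"
  have "\<not> M \<subseteq> V X F \<mu>" if \<mu>: "\<mu> \<in> filter_cardinals X F" for \<mu>
  proof
    assume "M \<subseteq> V X F \<mu>"
    then have "V X F \<mu> = M"
      using M(1) V_maximal[OF \<mu>] unfolding maximal_subsemigroup_def by blast
    then show False
      using none \<mu> by blast
  qed
  then have "rich_semigroup X F M"
    by (rule maximal_subsemigroup_rich[OF M])
  moreover have "rich_semigroup X F (setwise_inverse M)"
  proof (rule maximal_subsemigroup_rich)
    show max: "maximal_subsemigroup X (setwise_inverse M)"
      by (rule maximal_subsemigroup_setwise_inverse[OF M(1)])
    show "filter_stabiliser X F \<subseteq> setwise_inverse M"
      using M(2) setwise_inverse_mono[of "filter_stabiliser X F" M] setwise_inverse_stabiliser by simp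
    show "\<not> Sym X \<subseteq> setwise_inverse M"
      using M(3) setwise_inverse_mono[of "Sym X" M] setwise_inverse_Sym by simp
    fix \<mu> assume \<mu>: "\<mu> \<in> filter_cardinals X F"
    show "\<not> setwise_inverse M \<subseteq> V X F \<mu>"
    proof
      assume "setwise_inverse M \<subseteq> V X F \<mu>"
      then have "V X F \<mu> = setwise_inverse M"
        using max V_maximal[OF \<mu>] unfolding maximal_subsemigroup_def by blast
      then have "M = setwise_inverse (V X F \<mu>)"
        by simp
      then show False
        using none \<mu> by blast
    qed
  qed
  ultimately show False
    using rich_semigroup_pair_contains_Sym M(3) by blast
qed

text \<open>
  Here \<open>M\<close> is its own inverse, so it lies in a semigroup \<open>N\<close> if and only if it lies in the inverse
  semigroup \<open>N \<inter> N\<inverse>\<close>. Maximality can therefore be played off against these intersections, and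
  \<open>M\<close> alone plays both parts in \<open>rich_semigroup_pair_contains_Sym\<close>.
\<close>

lemma maximal_inverse_subsemigroup_cases:
  assumes M: "maximal_inverse_subsemigroup X M" "filter_stabiliser X F \<subseteq> M" "\<not> Sym X \<subseteq> M"
  shows "\<exists>\<mu>\<in>filter_cardinals X F. M = V X F \<mu> \<inter> setwise_inverse (V X F \<mu>)"
proof (rule ccontr)
  assume none: "\<not> ?thesis"
  have max: "N = M" if "inverse_subsemigroup X N" "N \<noteq> I" "M \<subseteq> N" for N
    using M(1) that unfolding maximal_inverse_subsemigroup_def by blast
  have sub: "subsemigroup X M" and conv: "f \<in> M \<Longrightarrow> f\<inverse> \<in> M" for f
    using M(1) unfolding maximal_inverse_subsemigroup_def inverse_subsemigroup_def by blast+
  have Minv: "setwise_inverse M = M"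
    unfolding set_eq_iff setwise_inverse_iff using conv by (metis converse_converse)
  have Int: "M \<inter> setwise_inverse M = M"
    using Minv by simp
  have into_Int: "M \<subseteq> N \<inter> setwise_inverse N" if "M \<subseteq> N" for N
    using that setwise_inverse_mono[of M N] Minv by simp
  have "rich_semigroup X F M"
  proof unfold_locales
    show "subsemigroup X M"
      by (rule sub)
    show "filter_stabiliser X F \<subseteq> M"
      by (rule M(2))
  next
    fix \<mu> assume \<mu>: "\<mu> \<in> filter_cardinals X F"
    show "\<not> M \<subseteq> V X F \<mu>"
    proof
      assume "M \<subseteq> V X F \<mu>"
      then have "V X F \<mu> \<inter> setwise_inverse (V X F \<mu>) = M"
        using max[OF _ _ into_Int] V_Int_maximal[OF \<mu>]
        unfolding maximal_inverse_subsemigroup_def by blast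
      then show False
        using none \<mu> by blast
    qed
  next
    fix A assume A: "A \<subseteq> X" "infinite A \<or> (\<exists>x. A = {x})"
    then have ne: "A \<noteq> {}"
      by auto
    let ?S = "collapse_defect_semigroup A"
    show "\<not> M \<subseteq> ?S"
    proof
      assume "M \<subseteq> ?S"
      moreover have "inverse_subsemigroup X (?S \<inter> setwise_inverse ?S)"
        by (rule inverse_subsemigroup_Int_setwise_inverse[OF collapse_defect_semigroup_subsemigroup[OF A(2)]])
      moreover have "?S \<inter> setwise_inverse ?S \<noteq> I"
        using collapse_defect_semigroup_proper[OF ne A(1)] collapse_defect_semigroup_subsemigroup[OF A(2)]
        unfolding subsemigroup_def by blast
      ultimately have "?S \<inter> setwise_inverse ?S = M"
        using max[OF _ _ into_Int] by blast
      moreover have "Sym X \<subseteq> ?S \<inter> setwise_inverse ?S"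
        using Sym_subset_collapse_defect_semigroup[OF ne] setwise_inverse_mono[of "Sym X" ?S]
          setwise_inverse_Sym by simp
      ultimately show False
        using M(3) by simp
    qed
  qed
  then show False
    using rich_semigroup_pair_contains_Sym M(3) Minv by simp
qed

lemma setwise_inverse_V:
  "setwise_inverse (V X F \<mu>) =
     {f \<in> I. \<mu> \<le>o defect X f \<or> Range f \<notin> F \<or> (preserves X F f \<and> collapse X f <o \<mu>)}
     \<union> small_rank X"
proof (rule set_eqI)
  fix f
  have "f\<inverse> \<in> small_rank X \<longleftrightarrow> f \<in> small_rank X"
    using small_rank_converse[of f] small_rank_converse[of "f\<inverse>"] by auto
  then show "f \<in> setwise_inverse (V X F \<mu>) \<longleftrightarrow> f \<in> {f \<in> I. \<mu> \<le>o defect X f \<or>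
      Range f \<notin> F \<or> (preserves X F f \<and> collapse X f <o \<mu>)} \<union> small_rank X"
    using preserves_converse_iff[of f]
    by (auto simp: setwise_inverse_iff V_iff defect_def collapse_def small_rank_def)
qed

lemma csum_ordLess_iff:
  assumes "Card_order \<mu>" "infinite (Field \<mu>)"
  shows "|A| +c |B| <o \<mu> \<longleftrightarrow> |A| <o \<mu> \<and> |B| <o \<mu>"
  unfolding csum_def Field_card_of
proof
  assume "|A <+> B| <o \<mu>"
  then show "|A| <o \<mu> \<and> |B| <o \<mu>"
    using ordLeq_ordLess_trans[OF card_of_Plus1] ordLeq_ordLess_trans[OF card_of_Plus2] by blast
next
  assume "|A| <o \<mu> \<and> |B| <o \<mu>"
  then show "|A <+> B| <o \<mu>"
    by (intro card_of_Plus_ordLess_infinite_Field[OF assms(2,1)]) simp_all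
qed

text \<open>
  Of the nine combinations of the three alternatives for \<open>f\<close> and for \<open>f\<inverse>\<close>, the four mixed ones
  that involve preservation are contradictory: a map that preserves \<open>F\<close> has domain and range in
  \<open>F\<close>, and neither collapse nor defect can be both below \<open>\<mu>\<close> and at least \<open>\<mu>\<close>. The remaining
  bound on the sum of collapse and defect is equivalent to the two separate bounds because
  \<open>\<mu>\<close> is infinite.
\<close>

lemma V_Int_setwise_inverse_V:
  assumes \<mu>: "\<mu> \<in> filter_cardinals X F"
  shows "V X F \<mu> \<inter> setwise_inverse (V X F \<mu>) =
     {f \<in> I.
        (\<mu> \<le>o collapse X f \<and> \<mu> \<le>o defect X f) \<or>
        (\<mu> \<le>o collapse X f \<and> Range f \<notin> F) \<or>
        (Domain f \<notin> F \<and> \<mu> \<le>o defect X f) \<or>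
        (Domain f \<notin> F \<and> Range f \<notin> F) \<or>
        (preserves X F f \<and> collapse X f +c defect X f <o \<mu>)}
     \<union> small_rank X"
proof (rule set_eqI)
  fix f
  note card = filter_cardinals_D(1,2)[OF \<mu>]
  have sum: "collapse X f +c defect X f <o \<mu> \<longleftrightarrow> collapse X f <o \<mu> \<and> defect X f <o \<mu>"
    unfolding collapse_def defect_def by (rule csum_ordLess_iff[OF card])
  have "\<not> (\<mu> \<le>o collapse X f \<and> collapse X f <o \<mu>)" "\<not> (\<mu> \<le>o defect X f \<and> defect X f <o \<mu>)"
    using not_ordLess_ordLeq by blast+
  moreover have "f \<in> I \<Longrightarrow> preserves X F f \<Longrightarrow> Domain f \<in> F \<and> Range f \<in> F"
    using preserves_Domain_Range by blast
  ultimately show "f \<in> V X F \<mu> \<inter> setwise_inverse (V X F \<mu>) \<longleftrightarrow> f \<in> {f \<in> I.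
        (\<mu> \<le>o collapse X f \<and> \<mu> \<le>o defect X f) \<or>
        (\<mu> \<le>o collapse X f \<and> Range f \<notin> F) \<or>
        (Domain f \<notin> F \<and> \<mu> \<le>o defect X f) \<or>
        (Domain f \<notin> F \<and> Range f \<notin> F) \<or>
        (preserves X F f \<and> collapse X f +c defect X f <o \<mu>)} \<union> small_rank X"
    unfolding Int_iff setwise_inverse_V unfolding V_def Un_iff mem_Collect_eq sum by blast
qed

lemma stabiliser_subset_setwise_inverse_V:
  assumes "\<mu> \<in> filter_cardinals X F"
  shows "filter_stabiliser X F \<subseteq> setwise_inverse (V X F \<mu>)"
  using stabiliser_subset_V[OF assms] setwise_inverse_mono[of "filter_stabiliser X F" "V X F \<mu>"]
    setwise_inverse_stabiliser by simp

lemma Sym_not_subset_setwise_inverse_V: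
  assumes "\<mu> \<in> filter_cardinals X F"
  shows "\<not> Sym X \<subseteq> setwise_inverse (V X F \<mu>)"
  using Sym_not_subset_V[OF assms] setwise_inverse_mono[of "Sym X" "V X F \<mu>"]
    setwise_inverse_Sym by simp

end

theorem theorem3p8:
  fixes X :: "'a set" and F :: "'a set set"
  assumes "infinite X" and "ultrafilter_on X F" and "nonprincipal X F"
  shows
    "{M. maximal_subsemigroup X M \<and> filter_stabiliser X F \<subseteq> M \<and> \<not> Sym X \<subseteq> M} =
       {V X F \<mu> | \<mu>. \<mu> \<in> filter_cardinals X F} \<union>
       {setwise_inverse (V X F \<mu>) | \<mu>. \<mu> \<in> filter_cardinals X F} \<and>
     (\<forall>\<mu>\<in>filter_cardinals X F.
       setwise_inverse (V X F \<mu>) =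
         {f \<in> sym_inv_monoid X.
            \<mu> \<le>o defect X f \<or> Range f \<notin> F \<or> (preserves X F f \<and> collapse X f <o \<mu>)}
         \<union> small_rank X) \<and>
     {M. maximal_inverse_subsemigroup X M \<and> filter_stabiliser X F \<subseteq> M \<and> \<not> Sym X \<subseteq> M} =
       {V X F \<mu> \<inter> setwise_inverse (V X F \<mu>) | \<mu>. \<mu> \<in> filter_cardinals X F} \<and>
     (\<forall>\<mu>\<in>filter_cardinals X F.
       V X F \<mu> \<inter> setwise_inverse (V X F \<mu>) =
         {f \<in> sym_inv_monoid X.
            (\<mu> \<le>o collapse X f \<and> \<mu> \<le>o defect X f) \<or>
            (\<mu> \<le>o collapse X f \<and> Range f \<notin> F) \<or>
            (Domain f \<notin> F \<and> \<mu> \<le>o defect X f) \<or>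
            (Domain f \<notin> F \<and> Range f \<notin> F) \<or>
            (preserves X F f \<and> collapse X f +c defect X f <o \<mu>)}
         \<union> small_rank X)"
proof (intro conjI ballI)
  interpret free_ultrafilter X F
    using assms by unfold_locales
  show "{M. maximal_subsemigroup X M \<and> filter_stabiliser X F \<subseteq> M \<and> \<not> Sym X \<subseteq> M} =
       {V X F \<mu> | \<mu>. \<mu> \<in> filter_cardinals X F} \<union>
       {setwise_inverse (V X F \<mu>) | \<mu>. \<mu> \<in> filter_cardinals X F}" (is "?L = ?R")
  proof
    show "?L \<subseteq> ?R"
      using maximal_subsemigroup_cases by blast
    have "V X F \<mu> \<in> ?L" "setwise_inverse (V X F \<mu>) \<in> ?L" if "\<mu> \<in> filter_cardinals X F" for \<mu>
      using V_maximal[OF that] maximal_subsemigroup_setwise_inverse[OF V_maximal[OF that]]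
        stabiliser_subset_V[OF that] stabiliser_subset_setwise_inverse_V[OF that]
        Sym_not_subset_V[OF that] Sym_not_subset_setwise_inverse_V[OF that] by simp_all
    then show "?R \<subseteq> ?L"
      by blast
  qed
  show "{M. maximal_inverse_subsemigroup X M \<and> filter_stabiliser X F \<subseteq> M \<and> \<not> Sym X \<subseteq> M} =
       {V X F \<mu> \<inter> setwise_inverse (V X F \<mu>) | \<mu>. \<mu> \<in> filter_cardinals X F}" (is "?L = ?R")
  proof
    show "?L \<subseteq> ?R"
      using maximal_inverse_subsemigroup_cases by blast
    have "V X F \<mu> \<inter> setwise_inverse (V X F \<mu>) \<in> ?L" if "\<mu> \<in> filter_cardinals X F" for \<mu>
      using V_Int_maximal[OF that] Sym_not_subset_V[OF that]
        stabiliser_subset_V[OF that] stabiliser_subset_setwise_inverse_V[OF that] by simp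
    then show "?R \<subseteq> ?L"
      by blast
  qed
  fix \<mu> assume \<mu>: "\<mu> \<in> filter_cardinals X F"
  show "setwise_inverse (V X F \<mu>) =
         {f \<in> sym_inv_monoid X.
            \<mu> \<le>o defect X f \<or> Range f \<notin> F \<or> (preserves X F f \<and> collapse X f <o \<mu>)}
         \<union> small_rank X"
    by (rule setwise_inverse_V)
  show "V X F \<mu> \<inter> setwise_inverse (V X F \<mu>) =
         {f \<in> sym_inv_monoid X.
            (\<mu> \<le>o collapse X f \<and> \<mu> \<le>o defect X f) \<or>
            (\<mu> \<le>o collapse X f \<and> Range f \<notin> F) \<or>
            (Domain f \<notin> F \<and> \<mu> \<le>o defect X f) \<or>
            (Domain f \<notin> F \<and> Range f \<notin> F) \<or>
            (preserves X F f \<and> collapse X f +c defect X f <o \<mu>)}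
         \<union> small_rank X"
    by (rule V_Int_setwise_inverse_V[OF \<mu>])
qed

end
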